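(* Let $\Upsilon$ be a gain signed graph. The closed sets (flats) of $M(\Upsilon)$ are exactly the sets of the forms $$[E{:}U]\cup[E(\zeta){:}\pi]\cup E^0 \qquad\text{and}\qquad [E(\theta){:}U]\cup[E(\theta,\zeta){:}\pi]\cup E^{00},$$ where $U\subseteq V$, $\pi$ is a partition of $V\setminus U$, $\zeta:V\setminus U\to\{\pm1\}$, and $\theta:V\to\mathbb{K}$ is a gain switcher. A closed set of the second form is always hyperbalanced, and every hyperbalanced closed set has the second form. The closed sets of $M_\infty(\Upsilon)$ are the same sets when hyperbalanced, and the same sets with $e_\infty$ added when hyperfrustrated.
   Context: Let $\mathbb{K}$ be a field of characteristic $\ne2$. A graph $\Gamma=(V,E)$ has vertex set $V=\{v_1,\dots,v_n\}$ and finite edge set $E$; edges are links (two ends at distinct vertices), loops (two ends at one vertex), half edges (one end) or loose edges (no ends); parallel edges allowed. A gain signed graph $\Upsilon=(\Gamma,\sigma,\varphi)$: $\sigma:E\to\{\pm1\}$ (half edges negative, loose edges positive); with an orientation $\tau$ (signs $\tau(v,e)\in\{\pm1\}$ on edge ends, $\tau(v,e)\tau(w,e)=-\sigma(e)$ for a link or loop with ends $v,w$) each edge has gain $\varphi(e)\in\mathbb{K}$, negated on reorientation. Neutral = gain $0$. Walk gain of $W=u_0e_1\cdots e_lu_l$: $\varphi(W)=-\sum_i\varphi(e_i)\sigma(W_{0,i-1})\tau(u_{i-1},e_i)$, $\sigma(W_{0,j})=\prod_{i\le j}\sigma(e_i)$. Ultrawalks may begin with a half edge $e_0$ at $u_0$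 and/or end with a half edge $e_{l+1}$ at $u_l$; their gain adds $\tau(u_0,e_0)\varphi(e_0)$ and/or $-\varphi(e_{l+1})\sigma(W_{0,l})\tau(u_l,e_{l+1})$ to $\varphi(W_{0,l})$. Circles: connected 2-regular subgraphs, sign = product of edge signs; a negative figure is a negative circle or a half edge. A sign circuit is a positive circle, a loose edge, or a handcuff (two negative figures with exactly one common vertex, or two disjoint negative figures plus a path joining them meeting them only at its ends). Its gain: the edge gain for a loose edge; else $\varphi(W)$ for a circuit walk (once around a positive circle; for a handcuff with figures $C_1,C_2$, connecting path $P$ of length $\ge0$: around $C_1$, along $P$, around $C_2$, back along $P$ if both circles; from half edge $C_1$ along $P$, around $C_2$, back, ending with $C_1$ if $C_1$ half edge and $C_2$ circle; from one half edge along $P$ to the other if both half edges); well defined up to sign; neutral if $0$. $S$ is hyperbalanced if all sign circuits in $S$ are neutral, hyperfrustrated otherwise; sign balanced if it has no negative circle and no half edge. Components: connected components of $(V,S)$ (loose edges excluded); $b_\Sigma(S)$ = number of sign-balanced components. $M(\Upsilon)$: matroid on $E$ with rank $n-b_\Sigma(S)+\delta(S)$ ($\delta=0$ if hyperbalanced, $1$ otherwise); $M_\infty(\Upsilon)$: same on $E\cup\{e_\infty\}$ with $e_\infty$ treated as a non-neutral loose edge. Notation: for $X\subseteq V$, $E{:}X$ = links, loops and half edges all of whose endpoints lie in $X$; for a partition $\pi$, $E{:}\pi=\bigcup_{B\in\pi}E{:}B$ (likewise for subsets $A\subseteq E$). $E^0$ = loose edges; $E^{00}$ = neutral loose edges.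 For $\zeta:X\to\{\pm1\}$, $E(\zeta)$ = links and loops with ends $v,w\in X$ and $\sigma(e)=\zeta(v)\zeta(w)$. A gain switcher $\theta:V\to\mathbb{K}$ defines $\varphi^\theta(e)=\tau(v,e)\theta(v)+\varphi(e)+\tau(w,e)\theta(w)$ (link/loop with ends $v,w$), $\tau(v,e)\theta(v)+\varphi(e)$ (half edge at $v$), $\varphi(e)$ (loose edge); $E(\theta)=\{e:\varphi^\theta(e)=0\}$; $E(\theta,\zeta)=E(\theta)\cap E(\zeta)$. *)

theory Defs
  imports "HOL-Library.Disjoint_Sets" "HOL-Library.FuncSet"
begin

section \<open>Gain signed graphs\<close>

text \<open>An edge is of the form \<open>Two v w\<close> (a link if \<open>v \<noteq> w\<close>, a loop if \<open>v = w\<close>), a half edge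
  \<open>One v\<close>, or a loose edge \<open>Loose\<close>. The order of the two ends of \<open>Two v w\<close> serves only to name
  them: \<open>False\<close> is the end at \<open>v\<close>, \<open>True\<close> the end at \<open>w\<close>. This keeps the two ends of a loop
  apart. The only end of \<open>One v\<close> is \<open>False\<close>.\<close>

datatype 'v ends = Two 'v 'v | One 'v | Loose

text \<open>\<open>ori e i\<close> is the orientation sign $\tau$ of end \<open>i\<close> of \<open>e\<close>, and \<open>gain e\<close> is the gain of \<open>e\<close>
  in this orientation.\<close>

record ('v, 'e, 'k) gsgraph =
  verts :: "'v set"
  edges :: "'e set"
  ends :: "'e \<Rightarrow> 'v ends"
  esign :: "'e \<Rightarrow> int"
  ori :: "'e \<Rightarrow> bool \<Rightarrow> int"
  gain :: "'e \<Rightarrow> 'k"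

locale gain_signed_graph =
  fixes G :: "('v, 'e, 'k::field) gsgraph"
  assumes finite_verts: "finite (verts G)"
    and finite_edges: "finite (edges G)"
    and ends_in_verts: "e \<in> edges G \<Longrightarrow> set_ends (ends G e) \<subseteq> verts G"
    and sign_range: "e \<in> edges G \<Longrightarrow> esign G e \<in> {1, -1}"
    and sign_half: "e \<in> edges G \<Longrightarrow> ends G e = One v \<Longrightarrow> esign G e = -1"
    and sign_loose: "e \<in> edges G \<Longrightarrow> ends G e = Loose \<Longrightarrow> esign G e = 1"
    and ori_two: "e \<in> edges G \<Longrightarrow> ends G e = Two v w \<Longrightarrow>
          ori G e False \<in> {1, -1} \<and> ori G e True \<in> {1, -1} \<and>
          ori G e False * ori G e True = - esign G e"
    and ori_half: "e \<in> edges G \<Longrightarrow> ends G e = One v \<Longrightarrow> ori G e False \<in> {1, -1}"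

definition loose_edges :: "('v, 'e, 'k) gsgraph \<Rightarrow> 'e set" where
  "loose_edges G = {e \<in> edges G. ends G e = Loose}"

definition neutral_loose_edges :: "('v, 'e, 'k::zero) gsgraph \<Rightarrow> 'e set" where
  "neutral_loose_edges G = {e \<in> loose_edges G. gain G e = 0}"

text \<open>$A{:}X$ and $A{:}\pi$\<close>

definition induced :: "('v, 'e, 'k) gsgraph \<Rightarrow> 'e set \<Rightarrow> 'v set \<Rightarrow> 'e set" where
  "induced G A X = {e \<in> A. ends G e \<noteq> Loose \<and> set_ends (ends G e) \<subseteq> X}"

definition induced_partition :: "('v, 'e, 'k) gsgraph \<Rightarrow> 'e set \<Rightarrow> 'v set set \<Rightarrow> 'e set" where
  "induced_partition G A \<pi> = (\<Union>B\<in>\<pi>. induced G A B)"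


section \<open>Walks\<close>

text \<open>A step \<open>(e, i)\<close> of a walk traverses the link or loop \<open>e\<close>, leaving by its end \<open>i\<close>.
  A walk is given by its initial vertex and its list of steps.\<close>

fun tail_vertex :: "('v, 'e, 'k) gsgraph \<Rightarrow> 'e \<times> bool \<Rightarrow> 'v" where
  "tail_vertex G (e, i) = (case ends G e of Two v w \<Rightarrow> (if i then w else v) | _ \<Rightarrow> undefined)"

fun head_vertex :: "('v, 'e, 'k) gsgraph \<Rightarrow> 'e \<times> bool \<Rightarrow> 'v" where
  "head_vertex G (e, i) = tail_vertex G (e, \<not> i)"

definition step :: "('v, 'e, 'k) gsgraph \<Rightarrow> 'e \<times> bool \<Rightarrow> bool" where
  "step G d \<longleftrightarrow> fst d \<in> edges G \<and> (\<exists>v w. ends G (fst d) = Two v w)"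

fun walk :: "('v, 'e, 'k) gsgraph \<Rightarrow> 'v \<Rightarrow> ('e \<times> bool) list \<Rightarrow> 'v \<Rightarrow> bool" where
  "walk G u [] v \<longleftrightarrow> u \<in> verts G \<and> u = v"
| "walk G u (d # W) v \<longleftrightarrow> step G d \<and> tail_vertex G d = u \<and> walk G (head_vertex G d) W v"

definition walk_verts :: "('v, 'e, 'k) gsgraph \<Rightarrow> 'v \<Rightarrow> ('e \<times> bool) list \<Rightarrow> 'v list" where
  "walk_verts G u W = u # map (head_vertex G) W"

definition walk_edges :: "('e \<times> bool) list \<Rightarrow> 'e set" where
  "walk_edges W = fst ` set W"

definition path :: "('v, 'e, 'k) gsgraph \<Rightarrow> 'v \<Rightarrow> ('e \<times> bool) list \<Rightarrow> 'v \<Rightarrow> bool" where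
  "path G u W v \<longleftrightarrow> walk G u W v \<and> distinct (walk_verts G u W)"

definition reverse_walk :: "('e \<times> bool) list \<Rightarrow> ('e \<times> bool) list" where
  "reverse_walk W = rev (map (\<lambda>(e, i). (e, \<not> i)) W)"

definition walk_sign :: "('v, 'e, 'k) gsgraph \<Rightarrow> ('e \<times> bool) list \<Rightarrow> int" where
  "walk_sign G W = (\<Prod>d\<leftarrow>W. esign G (fst d))"

definition walk_gain :: "('v, 'e, 'k::field) gsgraph \<Rightarrow> ('e \<times> bool) list \<Rightarrow> 'k" where
  "walk_gain G W =
     - (\<Sum>i<length W. case W ! i of (e, j) \<Rightarrow>
          gain G e * of_int (walk_sign G (take i W)) * of_int (ori G e j))"

text \<open>The gain of the ultrawalk that consists of an optional initial half edge, the walk \<open>W\<close>,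
  and an optional final half edge. The half edges do not enter the signs of the initial
  segments of \<open>W\<close>.\<close>

definition ultrawalk_gain ::
  "('v, 'e, 'k::field) gsgraph \<Rightarrow> 'e option \<Rightarrow> ('e \<times> bool) list \<Rightarrow> 'e option \<Rightarrow> 'k" where
  "ultrawalk_gain G h W h' =
     (case h of None \<Rightarrow> 0 | Some e \<Rightarrow> of_int (ori G e False) * gain G e)
     + walk_gain G W
     - (case h' of None \<Rightarrow> 0
        | Some e \<Rightarrow> gain G e * of_int (walk_sign G W) * of_int (ori G e False))"


section \<open>Sign circuits and hyperbalance\<close>

text \<open>Subgraphs without isolated vertices are represented by their edge sets.\<close>

definition verts_of :: "('v, 'e, 'k) gsgraph \<Rightarrow> 'e set \<Rightarrow> 'v set" where
  "verts_of G S = (\<Union>e\<in>S. set_ends (ends G e))"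

text \<open>A loop counts twice.\<close>

definition degree :: "('v, 'e, 'k) gsgraph \<Rightarrow> 'e set \<Rightarrow> 'v \<Rightarrow> nat" where
  "degree G S x = (\<Sum>e\<in>S. case ends G e of
      Two v w \<Rightarrow> of_bool (v = x) + of_bool (w = x) | One v \<Rightarrow> of_bool (v = x) | Loose \<Rightarrow> 0)"

definition adjacency :: "('v, 'e, 'k) gsgraph \<Rightarrow> 'e set \<Rightarrow> 'v rel" where
  "adjacency G S = {(v, w). \<exists>e\<in>S. ends G e = Two v w \<or> ends G e = Two w v}"

text \<open>Circles consist of links and loops only; a path with a half edge at each end is not a circle.\<close>

definition circle :: "('v, 'e, 'k) gsgraph \<Rightarrow> 'e set \<Rightarrow> bool" where
  "circle G C \<longleftrightarrow> C \<subseteq> edges G \<and> C \<noteq> {} \<and> (\<forall>e\<in>C. \<exists>v w. ends G e = Two v w) \<and>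
     (\<forall>v\<in>verts_of G C. degree G C v = 2) \<and>
     (\<forall>v\<in>verts_of G C. \<forall>w\<in>verts_of G C. (v, w) \<in> (adjacency G C)\<^sup>*)"

definition positive_circle :: "('v, 'e, 'k) gsgraph \<Rightarrow> 'e set \<Rightarrow> bool" where
  "positive_circle G C \<longleftrightarrow> circle G C \<and> (\<Prod>e\<in>C. esign G e) = 1"

definition negative_circle :: "('v, 'e, 'k) gsgraph \<Rightarrow> 'e set \<Rightarrow> bool" where
  "negative_circle G C \<longleftrightarrow> circle G C \<and> (\<Prod>e\<in>C. esign G e) = -1"

definition half_edge :: "('v, 'e, 'k) gsgraph \<Rightarrow> 'e \<Rightarrow> bool" where
  "half_edge G e \<longleftrightarrow> e \<in> edges G \<and> (\<exists>v. ends G e = One v)"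

definition negative_figure :: "('v, 'e, 'k) gsgraph \<Rightarrow> 'e set \<Rightarrow> bool" where
  "negative_figure G C \<longleftrightarrow> negative_circle G C \<or> (\<exists>e. half_edge G e \<and> C = {e})"

text \<open>\<open>handcuff G C\<^sub>1 C\<^sub>2 u P v\<close>: the negative figures \<open>C\<^sub>1\<close>, \<open>C\<^sub>2\<close> with the connecting path \<open>P\<close>
  from \<open>u\<close> to \<open>v\<close> form a handcuff. \<open>P\<close> has length 0 if the figures have one common vertex.\<close>

definition handcuff ::
  "('v, 'e, 'k) gsgraph \<Rightarrow> 'e set \<Rightarrow> 'e set \<Rightarrow> 'v \<Rightarrow> ('e \<times> bool) list \<Rightarrow> 'v \<Rightarrow> bool" where
  "handcuff G C\<^sub>1 C\<^sub>2 u P v \<longleftrightarrow>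
     negative_figure G C\<^sub>1 \<and> negative_figure G C\<^sub>2 \<and> C\<^sub>1 \<noteq> C\<^sub>2 \<and>
     (verts_of G C\<^sub>1 \<inter> verts_of G C\<^sub>2 = {u} \<and> P = [] \<and> u = v \<or>
      verts_of G C\<^sub>1 \<inter> verts_of G C\<^sub>2 = {} \<and> path G u P v \<and>
        set (walk_verts G u P) \<inter> verts_of G C\<^sub>1 = {u} \<and>
        set (walk_verts G u P) \<inter> verts_of G C\<^sub>2 = {v})"

definition sign_circuit :: "('v, 'e, 'k) gsgraph \<Rightarrow> 'e set \<Rightarrow> bool" where
  "sign_circuit G C \<longleftrightarrow>
     positive_circle G C \<or>
     (\<exists>e\<in>loose_edges G. C = {e}) \<or>
     (\<exists>C\<^sub>1 C\<^sub>2 u P v. handcuff G C\<^sub>1 C\<^sub>2 u P v \<and> C = C\<^sub>1 \<union> C\<^sub>2 \<union> walk_edges P)"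

text \<open>\<open>W\<close> goes once around the circle \<open>C\<close>, starting and ending at \<open>u\<close>.\<close>

definition around :: "('v, 'e, 'k) gsgraph \<Rightarrow> 'e set \<Rightarrow> 'v \<Rightarrow> ('e \<times> bool) list \<Rightarrow> bool" where
  "around G C u W \<longleftrightarrow> circle G C \<and> walk G u W u \<and> distinct (map fst W) \<and> walk_edges W = C"

text \<open>\<open>circuit_gain G C g\<close>: \<open>g\<close> is the gain of \<open>C\<close> computed from some circuit walk. Every sign
  circuit has a circuit walk, and its gain is determined up to sign. Handcuffs are unordered,
  so in \<open>half_circle\<close> the half edge may be taken as the first figure.\<close>

inductive circuit_gain :: "('v, 'e, 'k::field) gsgraph \<Rightarrow> 'e set \<Rightarrow> 'k \<Rightarrow> bool"
  for G where
  loose: "e \<in> loose_edges G \<Longrightarrow> circuit_gain G {e} (gain G e)"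
| positive_circle: "positive_circle G C \<Longrightarrow> around G C u W \<Longrightarrow> circuit_gain G C (walk_gain G W)"
| circle_circle:
    "handcuff G C\<^sub>1 C\<^sub>2 u P v \<Longrightarrow> around G C\<^sub>1 u W\<^sub>1 \<Longrightarrow> around G C\<^sub>2 v W\<^sub>2 \<Longrightarrow>
     circuit_gain G (C\<^sub>1 \<union> C\<^sub>2 \<union> walk_edges P) (walk_gain G (W\<^sub>1 @ P @ W\<^sub>2 @ reverse_walk P))"
| half_circle:
    "handcuff G {h} C\<^sub>2 u P v \<Longrightarrow> half_edge G h \<Longrightarrow> around G C\<^sub>2 v W\<^sub>2 \<Longrightarrow>
     circuit_gain G ({h} \<union> C\<^sub>2 \<union> walk_edges P)
       (ultrawalk_gain G (Some h) (P @ W\<^sub>2 @ reverse_walk P) (Some h))"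
| half_half:
    "handcuff G {h\<^sub>1} {h\<^sub>2} u P v \<Longrightarrow> half_edge G h\<^sub>1 \<Longrightarrow> half_edge G h\<^sub>2 \<Longrightarrow>
     circuit_gain G ({h\<^sub>1} \<union> {h\<^sub>2} \<union> walk_edges P) (ultrawalk_gain G (Some h\<^sub>1) P (Some h\<^sub>2))"

definition neutral_circuit :: "('v, 'e, 'k::field) gsgraph \<Rightarrow> 'e set \<Rightarrow> bool" where
  "neutral_circuit G C \<longleftrightarrow> (\<forall>g. circuit_gain G C g \<longrightarrow> g = 0)"

definition hyperbalanced :: "('v, 'e, 'k::field) gsgraph \<Rightarrow> 'e set \<Rightarrow> bool" where
  "hyperbalanced G S \<longleftrightarrow> (\<forall>C\<subseteq>S. sign_circuit G C \<longrightarrow> neutral_circuit G C)"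

abbreviation hyperfrustrated :: "('v, 'e, 'k::field) gsgraph \<Rightarrow> 'e set \<Rightarrow> bool" where
  "hyperfrustrated G S \<equiv> \<not> hyperbalanced G S"


section \<open>The matroids\<close>

definition sign_balanced :: "('v, 'e, 'k) gsgraph \<Rightarrow> 'e set \<Rightarrow> bool" where
  "sign_balanced G S \<longleftrightarrow> \<not> (\<exists>C\<subseteq>S. negative_circle G C) \<and> \<not> (\<exists>e\<in>S. half_edge G e)"

text \<open>Vertex sets of the connected components of $(V, S)$, isolated vertices included\<close>

definition components :: "('v, 'e, 'k) gsgraph \<Rightarrow> 'e set \<Rightarrow> 'v set set" where
  "components G S = verts G // (adjacency G S)\<^sup>*"

definition num_balanced :: "('v, 'e, 'k) gsgraph \<Rightarrow> 'e set \<Rightarrow> nat" where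
  "num_balanced G S = card {B \<in> components G S. sign_balanced G (induced G S B)}"

text \<open>The subtraction does not truncate: there are at most \<open>card (verts G)\<close> components.\<close>

definition gsg_rank :: "('v, 'e, 'k::field) gsgraph \<Rightarrow> 'e set \<Rightarrow> nat" where
  "gsg_rank G S = card (verts G) - num_balanced G S + (if hyperbalanced G S then 0 else 1)"

text \<open>A matroid is given by its ground set and its rank function.\<close>

record 'a rank_matroid =
  ground :: "'a set"
  rank :: "'a set \<Rightarrow> nat"

definition flats :: "'a rank_matroid \<Rightarrow> 'a set set" where
  "flats M = {F. F \<subseteq> ground M \<and> (\<forall>e\<in>ground M - F. rank M F < rank M (insert e F))}"

definition matroid_M :: "('v, 'e, 'k::field) gsgraph \<Rightarrow> 'e rank_matroid" where
  "matroid_M G = \<lparr>ground = edges G, rank = gsg_rank G\<rparr>"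

text \<open>The edge $e_\infty$ is \<open>None\<close>, a loose edge with gain 1; any nonzero gain would do.\<close>

definition add_infinity :: "('v, 'e, 'k::field) gsgraph \<Rightarrow> ('v, 'e option, 'k) gsgraph" where
  "add_infinity G =
     \<lparr>verts = verts G,
      edges = insert None (Some ` edges G),
      ends = case_option Loose (ends G),
      esign = case_option 1 (esign G),
      ori = case_option (\<lambda>_. 1) (ori G),
      gain = case_option 1 (gain G)\<rparr>"

definition matroid_M_inf :: "('v, 'e, 'k::field) gsgraph \<Rightarrow> 'e option rank_matroid" where
  "matroid_M_inf G = matroid_M (add_infinity G)"


section \<open>The two forms of closed sets\<close>

text \<open>$E(\zeta)$ for $\zeta : X \to \{\pm1\}$\<close>

definition edges_pot :: "('v, 'e, 'k) gsgraph \<Rightarrow> 'v set \<Rightarrow> ('v \<Rightarrow> int) \<Rightarrow> 'e set" where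
  "edges_pot G X \<zeta> = {e \<in> edges G. \<exists>v\<in>X. \<exists>w\<in>X. ends G e = Two v w \<and> esign G e = \<zeta> v * \<zeta> w}"

definition switched_gain :: "('v, 'e, 'k::field) gsgraph \<Rightarrow> ('v \<Rightarrow> 'k) \<Rightarrow> 'e \<Rightarrow> 'k" where
  "switched_gain G \<theta> e = (case ends G e of
      Two v w \<Rightarrow> of_int (ori G e False) * \<theta> v + gain G e + of_int (ori G e True) * \<theta> w
    | One v \<Rightarrow> of_int (ori G e False) * \<theta> v + gain G e
    | Loose \<Rightarrow> gain G e)"

text \<open>$E(\theta)$\<close>

definition edges_switch :: "('v, 'e, 'k::field) gsgraph \<Rightarrow> ('v \<Rightarrow> 'k) \<Rightarrow> 'e set" where
  "edges_switch G \<theta> = {e \<in> edges G. switched_gain G \<theta> e = 0}"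

definition first_form :: "('v, 'e, 'k) gsgraph \<Rightarrow> 'e set set" where
  "first_form G =
     {induced G (edges G) U \<union> induced_partition G (edges_pot G (verts G - U) \<zeta>) \<pi> \<union> loose_edges G
      | U \<pi> \<zeta>. U \<subseteq> verts G \<and> partition_on (verts G - U) \<pi> \<and> \<zeta> \<in> (verts G - U) \<rightarrow> {1, -1}}"

definition second_form :: "('v, 'e, 'k::field) gsgraph \<Rightarrow> 'e set set" where
  "second_form G =
     {induced G (edges_switch G \<theta>) U
        \<union> induced_partition G (edges_switch G \<theta> \<inter> edges_pot G (verts G - U) \<zeta>) \<pi>
        \<union> neutral_loose_edges G
      | U \<pi> \<zeta> \<theta>. U \<subseteq> verts G \<and> partition_on (verts G - U) \<pi> \<and> \<zeta> \<in> (verts G - U) \<rightarrow> {1, -1}}"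

end

(*
A walk W from u to v acts on potentials by the affine map t |-> gain(W) + sign(W) t (its transport),
and a gain switcher makes W neutral iff the transport of W sends its value at v to its value at u.
Negative closed walks act as involutions. A set S is hyperbalanced iff it lies in E(theta) for some
theta: half edges are replaced by negative loops of twice the gain, and a shortest positive closed
walk that does not act as the identity is either once around a positive circle or can be replaced,
without a change of length, by a walk L A M A^{-1} with L and M negative. If A is as long as possible,
then any further coincidence of vertices splits off a shorter such walk, so L, A, M form a handcuff.
Hence all positive closed walks act trivially, and fixed points of the closed walks at one vertex
of each component can be transported to a gain switcher.

The rank is controlled by the functions V -> {-1,0,1} that are compatible with the signs of S: there
are 3^b of them, where b is the number of balanced components, so b drops on adding e iff some such
function is incompatible with e. The sets of the first form are exactly the sets of edges that are
compatible with a given family of such functions; those of the second form are their intersections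
with sets E(theta).
*)

theory Submission
  imports Defs
begin

text \<open>As 2 is invertible, a negative closed walk is a reflection t |-> g - t with the single
  fixed point g/2, and a positive one is a translation. Once all translations are trivial, all
  reflections at a vertex share one centre, and a gain switcher exists. Neutrality of a handcuff
  says that the reflections of its two figures have the same centre after transport along the
  connecting path.

  The obstacle is that hyperbalance speaks only of simple subgraphs. Shortness alone does not
  produce them: if \<open>L\<close> is a lollipop, moving its stem into \<open>A\<close> leaves the
  total length unchanged, because the stem occurs twice in \<open>L\<close> and \<open>A\<close> is
  counted twice. Maximality of \<open>A\<close> settles this tie.

  The values -1, 0, 1 can be read as residues modulo 3: distinct ones stay distinct, so the
  compatible functions are the kernel of a signed incidence matrix over GF(3). Its size determines
  b, which avoids a direct study of how components merge when an edge is added.\<close>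

declare tail_vertex.simps [simp del] head_vertex.simps [simp del]

section \<open>Walks and their transport maps\<close>

definition opp :: "'e \<times> bool \<Rightarrow> 'e \<times> bool" where
  "opp d = (fst d, \<not> snd d)"

lemma fst_opp [simp]: "fst (opp d) = fst d" and opp_opp [simp]: "opp (opp d) = d"
  by (simp_all add: opp_def)

lemma reverse_walk_opp: "reverse_walk W = rev (map opp W)"
  by (simp add: reverse_walk_def opp_def case_prod_beta)

lemma reverse_walk_simps [simp]:
  "reverse_walk [] = []"
  "reverse_walk (d # W) = reverse_walk W @ [opp d]"
  "reverse_walk (W @ W') = reverse_walk W' @ reverse_walk W"
  "length (reverse_walk W) = length W"
  "reverse_walk W = [] \<longleftrightarrow> W = []"
  "walk_edges (reverse_walk W) = walk_edges W"
  by (auto simp: reverse_walk_opp walk_edges_def image_image)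

lemma reverse_walk_reverse_walk [simp]: "reverse_walk (reverse_walk W) = W"
  by (induction W) simp_all

lemma tail_opp [simp]: "tail_vertex G (opp d) = head_vertex G d"
  and head_opp [simp]: "head_vertex G (opp d) = tail_vertex G d"
  by (cases d; simp add: opp_def head_vertex.simps)+

lemma step_opp [simp]: "step G (opp d) = step G d"
  by (simp add: step_def)

lemma walk_sign_simps [simp]:
  "walk_sign G [] = 1"
  "walk_sign G (d # W) = esign G (fst d) * walk_sign G W"
  "walk_sign G (W @ W') = walk_sign G W * walk_sign G W'"
  "walk_sign G (reverse_walk W) = walk_sign G W"
proof -
  show app: "walk_sign G (W @ W') = walk_sign G W * walk_sign G W'" for W W'
    by (simp add: walk_sign_def)
  show "walk_sign G (reverse_walk W) = walk_sign G W"
    by (induction W) (simp_all add: app, simp_all add: walk_sign_def)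
qed (simp_all add: walk_sign_def)

lemma walk_gain_Nil [simp]: "walk_gain G [] = 0"
  by (simp add: walk_gain_def)

lemma walk_gain_Cons:
  "walk_gain G (d # W) =
     - gain G (fst d) * of_int (ori G (fst d) (snd d)) + of_int (esign G (fst d)) * walk_gain G W"
  by (simp add: walk_gain_def sum.lessThan_Suc_shift case_prod_beta sum_distrib_left
        algebra_simps del: sum.lessThan_Suc)

text \<open>The argument is a value at the last vertex and the result a value at the first one, so
  that concatenation of walks becomes composition in the same order.\<close>

definition transport :: "('v, 'e, 'k::field) gsgraph \<Rightarrow> ('e \<times> bool) list \<Rightarrow> 'k \<Rightarrow> 'k" where
  "transport G W t = walk_gain G W + of_int (walk_sign G W) * t"

definition dart_map :: "('v, 'e, 'k::field) gsgraph \<Rightarrow> 'e \<times> bool \<Rightarrow> 'k \<Rightarrow> 'k" where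
  "dart_map G d t = of_int (esign G (fst d)) * t - gain G (fst d) * of_int (ori G (fst d) (snd d))"

lemma transport_Nil [simp]: "transport G [] t = t"
  by (simp add: transport_def)

lemma transport_Cons [simp]: "transport G (d # W) t = dart_map G d (transport G W t)"
  by (simp add: transport_def dart_map_def walk_gain_Cons algebra_simps)

lemma transport_append [simp]: "transport G (W @ W') t = transport G W (transport G W' t)"
  by (induction W) simp_all

lemma transport_foldr: "transport G W = foldr (dart_map G) W"
  by (induction W) (simp_all add: fun_eq_iff)

context gain_signed_graph
begin

lemma step_ends:
  assumes "step G d"
  obtains v w where "fst d \<in> edges G" "ends G (fst d) = Two v w"
    "tail_vertex G d = (if snd d then w else v)" "head_vertex G d = (if snd d then v else w)"
  using assms
  by (cases d) (auto simp: step_def tail_vertex.simps head_vertex.simps)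

lemma step_verts:
  assumes "step G d" shows "tail_vertex G d \<in> verts G" "head_vertex G d \<in> verts G"
proof -
  obtain v w where "fst d \<in> edges G" "ends G (fst d) = Two v w"
    "tail_vertex G d = (if snd d then w else v)" "head_vertex G d = (if snd d then v else w)"
    by (rule step_ends[OF assms])
  then show "tail_vertex G d \<in> verts G" "head_vertex G d \<in> verts G"
    using ends_in_verts[of "fst d"] by auto
qed

lemma walk_ends_in_verts: "walk G u W v \<Longrightarrow> u \<in> verts G \<and> v \<in> verts G"
  by (induction W arbitrary: u) (auto simp: step_verts)

lemma walk_append_iff: "walk G u (W @ W') v \<longleftrightarrow> (\<exists>z. walk G u W z \<and> walk G z W' v)"
  by (induction W arbitrary: u) (auto dest: walk_ends_in_verts)

lemma walk_appendI: "walk G u W z \<Longrightarrow> walk G z W' v \<Longrightarrow> walk G u (W @ W') v"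
  using walk_append_iff by blast

lemma walk_reverse: "walk G u W v \<Longrightarrow> walk G v (reverse_walk W) u"
  by (induction W arbitrary: u) (auto simp: step_verts intro!: walk_appendI)

lemma walk_steps: "walk G u W v \<Longrightarrow> d \<in> set W \<Longrightarrow> step G d"
  by (induction W arbitrary: u) auto

lemma esign_cases: "e \<in> edges G \<Longrightarrow> esign G e = 1 \<or> esign G e = -1"
  using sign_range by blast

lemma walk_sign_cases: "walk G u W v \<Longrightarrow> walk_sign G W = 1 \<or> walk_sign G W = -1"
proof (induction W arbitrary: u)
  case (Cons d W)
  then have "fst d \<in> edges G" by (simp add: step_def)
  with Cons esign_cases[of "fst d"] show ?case by fastforce
qed simp

text \<open>The gain terms cancel because the orientation signs at the two ends multiply to minus
  the edge sign.\<close>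

lemma dart_map_opp:
  assumes "step G d" shows "dart_map G (opp d) (dart_map G d t) = t"
proof -
  obtain v w where d: "fst d \<in> edges G" "ends G (fst d) = Two v w"
    by (rule step_ends[OF assms])
  show ?thesis
    using ori_two[OF d] sign_range[OF d(1)]
    by (cases "snd d") (auto simp: dart_map_def opp_def algebra_simps)
qed

lemma transport_reverse:
  assumes "walk G u W v"
  shows "transport G (reverse_walk W) (transport G W t) = t"
    and "transport G W (transport G (reverse_walk W) t) = t"
proof -
  have *: "transport G (reverse_walk W) (transport G W t) = t" if "walk G u W v" for u W v t
    using that by (induction W arbitrary: u t) (auto simp: dart_map_opp)
  from *[OF assms] show "transport G (reverse_walk W) (transport G W t) = t" .
  from *[OF walk_reverse[OF assms]] show "transport G W (transport G (reverse_walk W) t) = t"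
    by simp
qed

lemma transport_inject:
  assumes "walk G u W v"
  shows "transport G W s = transport G W t \<longleftrightarrow> s = t"
  using transport_reverse[OF assms] by metis

end

lemma transport_negative:
  "walk_sign G W = -1 \<Longrightarrow> transport G W (transport G W t) = t"
  by (simp add: transport_def)

context gain_signed_graph
begin

lemma transport_reverse_negative:
  assumes "walk G u W v" "walk_sign G W = -1"
  shows "transport G (reverse_walk W) t = transport G W t"
  using transport_negative[OF assms(2)] transport_reverse(1)[OF assms(1)] by metis


text \<open>A value fixed by all closed walks at a representative can be carried to any vertex
  regardless of the route. The maps are abstract because there are two uses: affine maps for gain
  switchers, and multiplication by edge signs on {1, -1} for sign functions.\<close>

lemma global_section:
  fixes f :: "'e \<times> bool \<Rightarrow> 'a \<Rightarrow> 'a"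
  assumes inv: "\<And>d t. step G d \<Longrightarrow> f (opp d) (f d t) = t"
    and closed: "\<And>d t. step G d \<Longrightarrow> t \<in> X \<Longrightarrow> f d t \<in> X"
    and fixpoint: "\<And>r. r \<in> verts G \<Longrightarrow> \<exists>t\<in>X. \<forall>W. walk G r W r \<longrightarrow> foldr f W t = t"
  obtains \<theta> where "\<And>v. v \<in> verts G \<Longrightarrow> \<theta> v \<in> X"
    and "\<And>d. step G d \<Longrightarrow> \<theta> (tail_vertex G d) = f d (\<theta> (head_vertex G d))"
proof -
  \<comment> \<open>Adjacent vertices reach the same vertices by walks, so the choice operator gives
    them the same representative.\<close>
  define rep where "rep v = (SOME u. \<exists>W. walk G v W u)" for v
  define W where "W v = (SOME W. walk G v W (rep v))" for v
  obtain t where t: "\<And>r. r \<in> verts G \<Longrightarrow> t r \<in> X \<and> (\<forall>W. walk G r W r \<longrightarrow> foldr f W (t r) = t r)"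
    using fixpoint by metis
  have W: "walk G v (W v) (rep v)" if "v \<in> verts G" for v
  proof -
    have "\<exists>W. walk G v W v" using that by (intro exI[of _ "[]"]) simp
    then have "\<exists>W. walk G v W (rep v)"
      unfolding rep_def by (rule someI)
    then show ?thesis
      unfolding W_def by (rule someI_ex)
  qed
  have rep_eq: "rep (tail_vertex G d) = rep (head_vertex G d)" if d: "step G d" for d
  proof -
    have "(\<exists>W. walk G (tail_vertex G d) W u) = (\<exists>W. walk G (head_vertex G d) W u)" for u
    proof
      assume "\<exists>W. walk G (tail_vertex G d) W u"
      then obtain W where "walk G (tail_vertex G d) W u" ..
      with d have "walk G (head_vertex G d) (opp d # W) u" by simp
      then show "\<exists>W. walk G (head_vertex G d) W u" ..
    next
      assume "\<exists>W. walk G (head_vertex G d) W u"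
      then obtain W where "walk G (head_vertex G d) W u" ..
      with d have "walk G (tail_vertex G d) (d # W) u" by simp
      then show "\<exists>W. walk G (tail_vertex G d) W u" ..
    qed
    then show ?thesis by (simp add: rep_def)
  qed
  have backward: "foldr f (reverse_walk P) (foldr f P s) = s" if "walk G u P v" for u P v s
    using that by (induction P arbitrary: u s) (auto simp: inv)
  have cl: "foldr f P s \<in> X" if "walk G u P v" "s \<in> X" for u P v s
    using that by (induction P arbitrary: u) (auto simp: closed)
  define \<theta> where "\<theta> v = foldr f (W v) (t (rep v))" for v
  have rep_vert: "rep v \<in> verts G" if "v \<in> verts G" for v
    using W[OF that] walk_ends_in_verts by blast
  show ?thesis
  proof
    show "\<theta> v \<in> X" if "v \<in> verts G" for v
      unfolding \<theta>_def using cl[OF W[OF that]] t rep_vert[OF that] by blast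
    show "\<theta> (tail_vertex G d) = f d (\<theta> (head_vertex G d))" if d: "step G d" for d
    proof -
      let ?v = "tail_vertex G d" and ?w = "head_vertex G d" and ?s = "t (rep (tail_vertex G d))"
      have vw: "?v \<in> verts G" "?w \<in> verts G" using step_verts[OF d] .
      \<comment> \<open>That this closed walk fixes the value at the representative is the agreement
        of the two routes to \<open>?v\<close>: directly, and through \<open>d\<close>.\<close>
      have "walk G (rep ?v) (reverse_walk (W ?v) @ d # W ?w) (rep ?v)"
        using walk_reverse[OF W[OF vw(1)]] W[OF vw(2)] rep_eq[OF d] d
        by (intro walk_appendI) auto
      then have "foldr f (reverse_walk (W ?v)) (f d (foldr f (W ?w) ?s)) = ?s"
        using t[OF rep_vert[OF vw(1)]] by fastforce
      moreover have "foldr f (W ?v) (foldr f (reverse_walk (W ?v)) s) = s" for s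
        using backward[OF walk_reverse[OF W[OF vw(1)]]] by simp
      ultimately have "f d (foldr f (W ?w) ?s) = foldr f (W ?v) ?s"
        by metis
      then show ?thesis
        by (simp add: \<theta>_def rep_eq[OF d])
    qed
  qed
qed

end


section \<open>Minimal closed walks\<close>

definition neutral_below :: "('v, 'e, 'k::field) gsgraph \<Rightarrow> nat \<Rightarrow> bool" where
  "neutral_below G N \<longleftrightarrow>
     (\<forall>u W t. walk G u W u \<longrightarrow> walk_sign G W = 1 \<longrightarrow> length W < N \<longrightarrow> transport G W t = t)"

text \<open>The inequality says that the closed walk \<open>L @ A @ M @ reverse_walk A\<close> is not neutral;
  negative closed walks act as involutions.\<close>

definition cuffs ::
  "('v, 'e, 'k::field) gsgraph \<Rightarrow> 'v \<Rightarrow> ('e \<times> bool) list \<Rightarrow> ('e \<times> bool) list \<Rightarrow> 'v \<Rightarrow> ('e \<times> bool) list \<Rightarrow> bool"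
  where
  "cuffs G x L A y M \<longleftrightarrow>
     walk G x L x \<and> walk_sign G L = -1 \<and> walk G x A y \<and> walk G y M y \<and> walk_sign G M = -1 \<and>
     (\<exists>t. transport G L (transport G A t) \<noteq> transport G A (transport G M t))"

text \<open>The length of the closed walk \<open>L @ A @ M @ reverse_walk A\<close>.\<close>

definition cost :: "('e \<times> bool) list \<Rightarrow> ('e \<times> bool) list \<Rightarrow> ('e \<times> bool) list \<Rightarrow> nat" where
  "cost L A M = length L + 2 * length A + length M"

text \<open>Under \<open>neutral_below G N\<close> no cuffs cost less than \<open>N\<close>
  (\<open>cuffs_cost\<close>), so only the maximality of \<open>A\<close> has to be
  demanded.\<close>

definition minimal_cuffs ::
  "('v, 'e, 'k::field) gsgraph \<Rightarrow> nat \<Rightarrow> 'v \<Rightarrow> ('e \<times> bool) list \<Rightarrow> ('e \<times> bool) list \<Rightarrow> 'v \<Rightarrow> ('e \<times> bool) list \<Rightarrow> bool"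
  where
  "minimal_cuffs G N x L A y M \<longleftrightarrow> cuffs G x L A y M \<and> cost L A M = N \<and>
     (\<forall>x' L' A' y' M'. cuffs G x' L' A' y' M' \<longrightarrow> cost L' A' M' = N \<longrightarrow> length A' \<le> length A)"

section \<open>Shortening moves on extremal cuffs\<close>

context gain_signed_graph
begin

lemma cuffs_swap:
  assumes "cuffs G x L A y M" shows "cuffs G y M (reverse_walk A) x L"
proof -
  note A = assms[unfolded cuffs_def]
  obtain t where "transport G L (transport G A t) \<noteq> transport G A (transport G M t)"
    using A by blast
  then have "transport G M (transport G (reverse_walk A) (transport G A t))
    \<noteq> transport G (reverse_walk A) (transport G L (transport G A t))"
    using A by (metis transport_reverse)
  then show ?thesis using A by (auto simp: cuffs_def intro: walk_reverse)
qed

text \<open>A negative closed walk is an involution, so it acts as its own reversal.\<close>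

lemma cuffs_reverse:
  assumes "cuffs G x L A y M" shows "cuffs G x (reverse_walk L) A y M"
  using assms by (auto simp: cuffs_def walk_reverse transport_reverse_negative)

lemma cost_reverse: "cost L (reverse_walk A) M = cost M A L" "cost (reverse_walk L) A M = cost L A M"
  by (simp_all add: cost_def)

text \<open>Together with reversal of the first cuff, this symmetry allows the lemmas below to treat
  one cuff and one direction only.\<close>

lemma minimal_cuffs_swap:
  "minimal_cuffs G N x L A y M \<Longrightarrow> minimal_cuffs G N y M (reverse_walk A) x L"
  unfolding minimal_cuffs_def cost_reverse by (auto intro: cuffs_swap)

lemma minimal_cuffs_reverse:
  "minimal_cuffs G N x L A y M \<Longrightarrow> minimal_cuffs G N x (reverse_walk L) A y M"
  unfolding minimal_cuffs_def cost_reverse by (auto intro: cuffs_reverse)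

text \<open>Going out along \<open>W\<close> and back along \<open>W'\<close> is a positive closed
  walk of length below \<open>N\<close>, hence acts trivially.\<close>

lemma parallel_transport:
  assumes "neutral_below G N" "walk G u W v" "walk G u W' v" "walk_sign G W = walk_sign G W'"
    "length W + length W' < N"
  shows "transport G W t = transport G W' t"
proof -
  have "walk G u (W @ reverse_walk W') u" using assms walk_appendI walk_reverse by metis
  moreover have "walk_sign G (W @ reverse_walk W') = 1"
    using assms walk_sign_cases[OF assms(2)] by auto
  ultimately have "transport G (W @ reverse_walk W') (transport G W' t) = transport G W' t"
    using assms(1,5) unfolding neutral_below_def by (metis length_append reverse_walk_simps(4))
  then show ?thesis using transport_reverse[OF assms(3)] by simp
qed

text \<open>Otherwise \<open>L @ A @ M @ reverse_walk A\<close>, a positive closed walk, would be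
  short enough to act trivially, which is the equality that \<open>cuffs\<close> excludes.\<close>

lemma cuffs_cost:
  assumes N: "neutral_below G N" and c: "cuffs G x L A y M"
  shows "N \<le> cost L A M"
proof (rule ccontr)
  assume less: "\<not> ?thesis"
  note c = c[unfolded cuffs_def]
  obtain t where t: "transport G L (transport G A t) \<noteq> transport G A (transport G M t)"
    using c by blast
  have "walk G x (L @ A @ M @ reverse_walk A) x"
    using c by (meson walk_appendI walk_reverse)
  moreover have "walk_sign G (L @ A @ M @ reverse_walk A) = 1"
    using c walk_sign_cases[of x A y] by auto
  ultimately have "transport G (L @ A @ M @ reverse_walk A) s = s" for s
    using N less unfolding neutral_below_def cost_def by fastforce
  from this[of "transport G A (transport G M t)"] show False
    using t c transport_reverse[of x A y] transport_negative[of G M] by simp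
qed

text \<open>A proper closed piece \<open>D\<close> of the first cuff allows an improvement. If
  \<open>D\<close> is positive, it acts trivially and can be deleted. If it is negative,
  \<open>C @ E\<close> is a short positive closed walk, so \<open>E\<close> acts as the reversal of
  \<open>C\<close>; then \<open>D\<close> alone can be the cuff, with reversed \<open>C\<close> or
  \<open>E\<close> put in front of \<open>A\<close>.\<close>

lemma minimal_cuffs_first:
  assumes N: "neutral_below G N" and c: "minimal_cuffs G N x (C @ D @ E) A y M"
    and w: "walk G x C z" "walk G z D z" "walk G z E x" and D: "D \<noteq> []"
  shows "C @ E = []"
proof (rule ccontr)
  assume CE: "C @ E \<noteq> []"
  have cu: "cuffs G x (C @ D @ E) A y M" and cN: "cost (C @ D @ E) A M = N"
    and mx: "\<And>x' L' A' y' M'. cuffs G x' L' A' y' M' \<Longrightarrow> cost L' A' M' = N \<Longrightarrow> length A' \<le> length A"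
    using c by (auto simp: minimal_cuffs_def)
  note cd = cu[unfolded cuffs_def]
  have lt: "length D < N" "length C + length E < N"
    using cN CE D by (auto simp: cost_def)
  obtain t where t: "transport G C (transport G D (transport G E (transport G A t)))
      \<noteq> transport G A (transport G M t)"
    using cd by auto
  consider "walk_sign G D = 1" | "walk_sign G D = -1" using walk_sign_cases[OF w(2)] by blast
  then show False
  proof cases
    case 1
    then have "transport G D s = s" for s
      using N w(2) lt(1) by (auto simp: neutral_below_def)
    then have "cuffs G x (C @ E) A y M"
      using cd t 1 walk_appendI[OF w(1,3)] by (auto simp: cuffs_def)
    from cuffs_cost[OF N this] show False
      using cN D by (cases D; simp add: cost_def)
  next
    case 2
    have "walk_sign G C * walk_sign G E = 1" using cd 2 by simp
    then have sg: "walk_sign G (reverse_walk C) = walk_sign G E"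
      using walk_sign_cases[OF w(1)] walk_sign_cases[OF w(3)] by auto
    have E: "transport G E s = transport G (reverse_walk C) s" for s
      using parallel_transport[OF N w(3) walk_reverse[OF w(1)] sg[symmetric]] lt(2) by simp
    have *: "transport G D (transport G (reverse_walk C) (transport G A t))
      \<noteq> transport G (reverse_walk C) (transport G A (transport G M t))"
      using t E transport_reverse[OF w(1)] by metis
    have c1: "cuffs G z D (reverse_walk C @ A) y M" and c2: "cuffs G z D (E @ A) y M"
      using cd * 2 w walk_reverse[OF w(1)] E
      by (auto simp: cuffs_def intro: walk_appendI)
    \<comment> \<open>The two candidates change the cost by |C| - |E| and by |E| - |C|. At equal
      lengths the cost does not drop, and maximality of \<open>A\<close> forces \<open>C\<close> to
      be empty.\<close>
    show False
    proof (cases "length C \<le> length E")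
      case True
      have "cost D (reverse_walk C @ A) M = N"
        using cuffs_cost[OF N c1] True cN by (simp add: cost_def)
      with mx[OF c1] have "C = []" by auto
      moreover from this have "E = []"
        using cuffs_cost[OF N c1] cN by (cases E; simp add: cost_def)
      ultimately show False using CE by simp
    next
      case False
      then show False using cuffs_cost[OF N c2] cN by (simp add: cost_def)
    qed
  qed
qed

text \<open>A negative closed piece \<open>D\<close> of the connecting walk would give two cheaper
  pairs of cuffs, \<open>L\<close>, \<open>D\<close> along \<open>C\<close> and \<open>D\<close>,
  \<open>M\<close> along \<open>E\<close>. Both pairs agree under transport, and so do
  \<open>L\<close> and \<open>M\<close> along the whole walk.\<close>

lemma minimal_cuffs_link:
  assumes N: "neutral_below G N" and c: "minimal_cuffs G N x L (C @ D @ E) y M"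
    and w: "walk G x C z" "walk G z D z" "walk G z E y"
  shows "D = []"
proof (rule ccontr)
  assume D: "D \<noteq> []"
  have cu: "cuffs G x L (C @ D @ E) y M" and cN: "cost L (C @ D @ E) M = N"
    using c by (auto simp: minimal_cuffs_def)
  note cd = cu[unfolded cuffs_def]
  have lt: "length D < N"
    using cN D by (auto simp: cost_def)
  obtain t where t: "transport G L (transport G C (transport G D (transport G E t)))
      \<noteq> transport G C (transport G D (transport G E (transport G M t)))"
    using cd by auto
  consider "walk_sign G D = 1" | "walk_sign G D = -1" using walk_sign_cases[OF w(2)] by blast
  then show False
  proof cases
    case 1
    then have "transport G D s = s" for s
      using N w(2) lt(1) by (auto simp: neutral_below_def)
    then have "cuffs G x L (C @ E) y M"
      using cd t 1 walk_appendI[OF w(1,3)] by (auto simp: cuffs_def)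
    from cuffs_cost[OF N this] show False
      using cN D by (cases D; simp add: cost_def)
  next
    case 2
    have "cost L C D < N" "cost D E M < N"
      using cN D by (cases D; simp add: cost_def)+
    then have "\<not> cuffs G x L C z D" "\<not> cuffs G z D E y M"
      using cuffs_cost[OF N] by (meson not_le)+
    then have "transport G L (transport G C s) = transport G C (transport G D s)"
      "transport G D (transport G E s) = transport G E (transport G M s)" for s
      using cd w 2 unfolding cuffs_def by blast+
    then show False using t by simp
  qed
qed

lemma minimal_cuffs_first_link:
  assumes N: "neutral_below G N" and c: "minimal_cuffs G N x (C @ D) (E @ F) y M"
    and w: "walk G x C z" "walk G z D x" "walk G x E z" "walk G z F y"
    and CD: "C \<noteq> []" "D \<noteq> []"
  shows "E = []"
proof (rule ccontr)
  assume E: "E \<noteq> []"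
  \<comment> \<open>The case in which the arc \<open>C\<close> has the sign of \<open>E\<close>;
    reversing the cuff reduces the other case to it.\<close>
  have *: False if c: "minimal_cuffs G N x (C @ D) (E @ F) y M"
    and w: "walk G x C z" "walk G z D x"
    and D: "D \<noteq> []" and sg: "walk_sign G C = walk_sign G E" for C D
  proof -
    have cu: "cuffs G x (C @ D) (E @ F) y M" and cN: "cost (C @ D) (E @ F) M = N"
      using c by (auto simp: minimal_cuffs_def)
    note cd = cu[unfolded cuffs_def]
    have CE: "transport G C s = transport G E s" for s
      by (rule parallel_transport[OF N w(1) \<open>walk G x E z\<close> sg])
        (use cN D in \<open>auto simp: cost_def\<close>)
    obtain t where t: "transport G E (transport G D (transport G C (transport G F t)))
        \<noteq> transport G E (transport G F (transport G M t))"
      using cd CE by auto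
    then have "transport G D (transport G C (transport G F t)) \<noteq> transport G F (transport G M t)"
      by metis
    then have "cuffs G z (D @ C) F y M"
      using cd w \<open>walk G z F y\<close> by (auto simp: cuffs_def mult.commute intro: walk_appendI)
    from cuffs_cost[OF N this] show False
      using cN E by (cases E; simp add: cost_def)
  qed
  have "walk_sign G (C @ D) = -1" using c by (simp add: minimal_cuffs_def cuffs_def)
  then have "walk_sign G C = walk_sign G E \<or> walk_sign G (reverse_walk D) = walk_sign G E"
    using walk_sign_cases[OF w(1)] walk_sign_cases[OF w(2)] walk_sign_cases[OF w(3)] by auto
  moreover have "minimal_cuffs G N x (reverse_walk D @ reverse_walk C) (E @ F) y M"
    using minimal_cuffs_reverse[OF c] by simp
  ultimately show False
    using *[OF c w(1,2) CD(2)] *[OF _ walk_reverse[OF w(2)] walk_reverse[OF w(1)]] CD(1) by auto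
qed

text \<open>If both cuffs pass through \<open>z\<close>, then, up to reversal of the first cuff,
  \<open>C\<close> acts like \<open>A @ E\<close> and \<open>D\<close> like
  \<open>F @ reverse_walk A\<close>. Their product is the second cuff conjugated by
  \<open>A\<close>, which \<open>cuffs\<close> forbids.\<close>

lemma minimal_cuffs_first_second:
  assumes N: "neutral_below G N" and c: "minimal_cuffs G N x (C @ D) A y (E @ F)"
    and w: "walk G x C z" "walk G z D x" "walk G y E z" "walk G z F y"
    and CD: "C \<noteq> []" "D \<noteq> []"
  shows False
proof -
  have A: "walk G x A y" using c by (simp add: minimal_cuffs_def cuffs_def)
  have *: False if c: "minimal_cuffs G N x (C @ D) A y (E @ F)"
    and w: "walk G x C z" "walk G z D x" and CD: "C \<noteq> []" "D \<noteq> []"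
    and sg: "walk_sign G C = walk_sign G (A @ E)" for C D
  proof -
    have cu: "cuffs G x (C @ D) A y (E @ F)" and cN: "cost (C @ D) A (E @ F) = N"
      using c by (auto simp: minimal_cuffs_def)
    note cd = cu[unfolded cuffs_def]
    have C: "transport G C s = transport G (A @ E) s" for s
      by (rule parallel_transport[OF N w(1) walk_appendI[OF A \<open>walk G y E z\<close>] sg])
        (use cN CD in \<open>auto simp: cost_def\<close>)
    have "walk_sign G D = walk_sign G (F @ reverse_walk A)"
      using cd sg walk_sign_cases[OF w(2)] walk_sign_cases[OF \<open>walk G y E z\<close>]
        walk_sign_cases[OF \<open>walk G z F y\<close>] walk_sign_cases[OF A] by auto
    then have D: "transport G D s = transport G (F @ reverse_walk A) s" for s
      by (rule parallel_transport[OF N w(2) walk_appendI[OF \<open>walk G z F y\<close> walk_reverse[OF A]]])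
        (use cN CD in \<open>auto simp: cost_def\<close>)
    show False
      using cd C D transport_reverse(1)[OF A] by simp
  qed
  have "walk_sign G (C @ D) = -1" using c by (simp add: minimal_cuffs_def cuffs_def)
  then have "walk_sign G C = walk_sign G (A @ E) \<or> walk_sign G (reverse_walk D) = walk_sign G (A @ E)"
    using walk_sign_cases[OF w(1)] walk_sign_cases[OF w(2)]
      walk_sign_cases[OF walk_appendI[OF A w(3)]] by auto
  moreover have "minimal_cuffs G N x (reverse_walk D @ reverse_walk C) A y (E @ F)"
    using minimal_cuffs_reverse[OF c] by simp
  ultimately show False
    using *[OF c w(1,2) CD] *[OF _ walk_reverse[OF w(2)] walk_reverse[OF w(1)]] CD by auto
qed

end

section \<open>Circles as closed walks\<close>

lemma not_distinct_map_decomp: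
  "\<not> distinct (map f W) \<Longrightarrow> \<exists>C d D e E. W = C @ (d # D) @ (e # E) \<and> f d = f e"
proof (induction W)
  case (Cons a W)
  show ?case
  proof (cases "f a \<in> f ` set W")
    case True
    then obtain e D E where "f e = f a" "W = D @ e # E" using split_list by fastforce
    then have "a # W = [] @ (a # D) @ (e # E) \<and> f a = f e" by simp
    then show ?thesis by blast
  next
    case False
    with Cons obtain C d D e E where "W = C @ (d # D) @ (e # E) \<and> f d = f e" by auto
    then have "a # W = (a # C) @ (d # D) @ (e # E) \<and> f d = f e" by simp
    then show ?thesis by blast
  qed
qed simp

context gain_signed_graph
begin

lemma walk_split:
  assumes "walk G x W y" "v \<in> set (map (tail_vertex G) W)"
  obtains C D where "W = C @ D" "D \<noteq> []" "walk G x C v" "walk G v D y"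
proof -
  obtain d where d: "d \<in> set W" "v = tail_vertex G d" using assms(2) by auto
  then obtain C D where W: "W = C @ d # D" using split_list by metis
  with assms(1) obtain z where "walk G x C z" "walk G z (d # D) y" by (auto simp: walk_append_iff)
  with d W show ?thesis by (intro that[of C "d # D"]) auto
qed

lemma walk_split_repeated:
  assumes "walk G x W y" "\<not> distinct (map (tail_vertex G) W)"
  obtains C D E z where "W = C @ D @ E" "D \<noteq> []" "E \<noteq> []"
    "walk G x C z" "walk G z D z" "walk G z E y"
proof -
  obtain C d D e E v where W: "W = C @ (d # D) @ (e # E)" "tail_vertex G d = v" "tail_vertex G e = v"
    using not_distinct_map_decomp[OF assms(2)] by metis
  with assms(1) obtain z z' where w: "walk G x C z" "walk G z (d # D) z'" "walk G z' (e # E) y"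
    by (auto simp: walk_append_iff)
  with W have "z = v" "z' = v" by auto
  with W w show ?thesis by (intro that[of C "d # D" "e # E" v]) auto
qed

lemma walk_verts_tails:
  "walk G x W y \<Longrightarrow> walk_verts G x W = map (tail_vertex G) W @ [y]"
  by (induction W arbitrary: x) (auto simp: walk_verts_def)

lemma walk_verts_reverse:
  "walk G x W y \<Longrightarrow> walk_verts G y (reverse_walk W) = rev (walk_verts G x W)"
  by (subst walk_verts_tails[OF walk_reverse])
    (auto simp: walk_verts_def reverse_walk_opp rev_map comp_def)

lemma walk_split_verts:
  assumes "walk G x W y" "v \<in> set (walk_verts G x W)"
  obtains C D where "W = C @ D" "walk G x C v" "walk G v D y"
proof (cases "v = y")
  case True
  with assms(1) walk_ends_in_verts show ?thesis by (intro that[of W "[]"]) auto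
next
  case False
  with assms show ?thesis
    using walk_split[OF assms(1)] that by (auto simp: walk_verts_tails)
qed

text \<open>One-sided on purpose: applied to the swapped cuffs it yields the same for
  \<open>M\<close>, and the last two claims with \<open>y\<close> in place of
  \<open>x\<close>.\<close>

lemma minimal_cuffs_simple:
  assumes N: "neutral_below G N" and c: "minimal_cuffs G N x L A y M"
  shows "distinct (map (tail_vertex G) L)" (is ?L)
    and "path G x A y" (is ?A)
    and "set (walk_verts G x A) \<inter> set (map (tail_vertex G) L) = {x}" (is ?LA)
    and "set (map (tail_vertex G) L) \<inter> set (map (tail_vertex G) M) \<subseteq> {x}" (is ?LM)
proof -
  have w: "walk G x L x" "walk G x A y" "walk G y M y" and L0: "L \<noteq> []"
    using c by (auto simp: minimal_cuffs_def cuffs_def)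
  show ?L
  proof (rule ccontr)
    assume "\<not> ?L"
    then obtain C D E z where "L = C @ D @ E" "D \<noteq> []" "E \<noteq> []"
      "walk G x C z" "walk G z D z" "walk G z E x"
      using walk_split_repeated[OF w(1)] by metis
    with minimal_cuffs_first[OF N, of x C D E] c show False by auto
  qed
  show ?A
  proof (rule ccontr)
    assume "\<not> ?A"
    then have "\<not> distinct (map (tail_vertex G) A) \<or> y \<in> set (map (tail_vertex G) A)"
      using w(2) by (auto simp: path_def walk_verts_tails)
    then obtain C D E z where "A = C @ D @ E" "D \<noteq> []"
      "walk G x C z" "walk G z D z" "walk G z E y"
    proof
      assume "\<not> distinct (map (tail_vertex G) A)"
      then show ?thesis using that walk_split_repeated[OF w(2)] by metis
    next
      assume "y \<in> set (map (tail_vertex G) A)"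
      then obtain C D where "A = C @ D" "D \<noteq> []" "walk G x C y" "walk G y D y"
        using walk_split[OF w(2)] by metis
      then show ?thesis using that[of C D "[]" y] walk_ends_in_verts by auto
    qed
    with minimal_cuffs_link[OF N, of x L C D E] c show False by auto
  qed
  show ?LA
  proof
    show "{x} \<subseteq> set (walk_verts G x A) \<inter> set (map (tail_vertex G) L)"
      using L0 w(1) by (cases L) (auto simp: walk_verts_def)
    show "set (walk_verts G x A) \<inter> set (map (tail_vertex G) L) \<subseteq> {x}"
    proof
      fix v assume v: "v \<in> set (walk_verts G x A) \<inter> set (map (tail_vertex G) L)"
      obtain C D where L: "L = C @ D" "D \<noteq> []" "walk G x C v" "walk G v D x"
        using walk_split[OF w(1)] v by blast
      obtain E F where A: "A = E @ F" "walk G x E v" "walk G v F y"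
        using walk_split_verts[OF w(2)] v by blast
      have "C = [] \<or> E = []"
        using minimal_cuffs_first_link[OF N, of x C D E F y M v] c L A by auto
      with L A show "v \<in> {x}" by auto
    qed
  qed
  show ?LM
  proof
    fix v assume v: "v \<in> set (map (tail_vertex G) L) \<inter> set (map (tail_vertex G) M)"
    obtain C D where L: "L = C @ D" "D \<noteq> []" "walk G x C v" "walk G v D x"
      using walk_split[OF w(1)] v by blast
    obtain E F where M: "M = E @ F" "walk G y E v" "walk G v F y"
      using walk_split[OF w(3)] v by blast
    have "C = []"
      using minimal_cuffs_first_second[OF N, of x C D A y E F v] c L M by auto
    with L show "v \<in> {x}" by auto
  qed
qed

text \<open>Distinct tails force the second traversal to go the opposite way. The remaining pieces
  of the walk would revisit a vertex already used, so they are empty. This is the degenerate closed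
  walk that has distinct tails without being a circle.\<close>

lemma closed_walk_repeated_edge:
  assumes w: "walk G u W u" and tails: "distinct (map (tail_vertex G) W)"
    and rep: "\<not> distinct (map fst W)"
  obtains d where "W = [d, opp d]"
proof -
  obtain A d B d' C where W: "W = A @ (d # B) @ (d' # C)" "fst d = fst d'"
    using not_distinct_map_decomp[OF rep] by blast
  with tails have "d \<noteq> d'" by auto
  with W(2) have d': "d' = opp d" by (cases d; cases d') (auto simp: opp_def)
  obtain z where wA: "walk G u A z" "walk G z ((d # B) @ (d' # C)) u"
    using w W by (auto simp: walk_append_iff)
  then obtain z' where "walk G z (d # B) z'" "walk G z' (d' # C) u"
    unfolding walk_append_iff by blast
  then have wB: "walk G (head_vertex G d) B (head_vertex G d)" and wC: "walk G (tail_vertex G d) C u"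
    by (auto simp: d')
  have tails': "distinct (map (tail_vertex G) A @ (tail_vertex G d # map (tail_vertex G) B)
      @ head_vertex G d # map (tail_vertex G) C)"
    using tails unfolding W(1) d' by (simp del: distinct_append)
  have "B = []" using wB tails' by (cases B) auto
  moreover have "C = []" using wC tails' by (cases C) auto
  moreover from this have "tail_vertex G d = u" using wC by simp
  then have "A = []" using wA(1) tails' by (cases A) auto
  ultimately show ?thesis using that W d' by simp
qed

lemma walk_adjacency:
  "walk G u W v \<Longrightarrow> walk_edges W \<subseteq> S \<Longrightarrow> (u, v) \<in> (adjacency G S)\<^sup>*"
proof (induction W arbitrary: u)
  case (Cons d W)
  then have d: "step G d" "fst d \<in> S" by (auto simp: walk_edges_def)
  have "(tail_vertex G d, head_vertex G d) \<in> adjacency G S"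
    by (rule step_ends[OF d(1)]) (use d(2) in \<open>auto simp: adjacency_def\<close>)
  with Cons show ?case by (auto simp: walk_edges_def intro: converse_rtrancl_into_rtrancl)
qed simp

lemma walk_edges_subset: "walk G u W v \<Longrightarrow> walk_edges W \<subseteq> edges G"
  using walk_steps by (fastforce simp: walk_edges_def step_def)

lemma verts_of_walk:
  assumes "walk G u W u"
  shows "verts_of G (walk_edges W) = set (map (tail_vertex G) W)"
proof -
  have *: "set_ends (ends G (fst d)) = {tail_vertex G d, head_vertex G d}" if "d \<in> set W" for d
    by (rule step_ends[OF walk_steps[OF assms that]]) auto
  have "set (u # map (head_vertex G) W) = set (map (tail_vertex G) W @ [u])"
    using walk_verts_tails[OF assms] unfolding walk_verts_def by (rule arg_cong)
  moreover have "u \<in> set (map (tail_vertex G) W)" if "W \<noteq> []"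
    using assms that by (cases W) auto
  ultimately have "head_vertex G ` set W \<subseteq> tail_vertex G ` set W"
    by (cases "W = []") auto
  moreover have "verts_of G (walk_edges W) = tail_vertex G ` set W \<union> head_vertex G ` set W"
    using * by (auto simp: verts_of_def walk_edges_def)
  ultimately show ?thesis by auto
qed

lemma distinct_count_list: "distinct xs \<Longrightarrow> x \<in> set xs \<Longrightarrow> count_list xs x = 1"
  by (induction xs) auto

lemma sum_list_of_bool: "(\<Sum>d\<leftarrow>W. of_bool (g d = x)) = count_list (map g W) x"
  by (induction W) auto

text \<open>Each vertex occurs once as a tail and once as a head, and each edge contributes its tail
  and its head to the degrees.\<close>

lemma circle_walk:
  assumes w: "walk G u W u" and W: "W \<noteq> []" and tails: "distinct (map (tail_vertex G) W)"
    and dist: "distinct (map fst W)"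
  shows "circle G (walk_edges W)"
  unfolding circle_def
proof (intro conjI ballI)
  show "walk_edges W \<subseteq> edges G" using walk_edges_subset[OF w] .
  show "walk_edges W \<noteq> {}" using W by (simp add: walk_edges_def)
  show "\<exists>v w. ends G e = Two v w" if "e \<in> walk_edges W" for e
    using that walk_steps[OF w] by (auto simp: walk_edges_def step_def)
next
  fix x assume x: "x \<in> verts_of G (walk_edges W)"
  have deg: "(case ends G (fst d) of
      Two v w \<Rightarrow> of_bool (v = x) + of_bool (w = x) | One v \<Rightarrow> of_bool (v = x) | Loose \<Rightarrow> 0)
    = of_bool (tail_vertex G d = x) + (of_bool (head_vertex G d = x) :: nat)" if "d \<in> set W" for d
    by (rule step_ends[OF walk_steps[OF w that]]) auto
  have "degree G (walk_edges W) x = (\<Sum>d\<leftarrow>W. case ends G (fst d) of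
      Two v w \<Rightarrow> of_bool (v = x) + of_bool (w = x) | One v \<Rightarrow> of_bool (v = x) | Loose \<Rightarrow> 0)"
    unfolding degree_def walk_edges_def set_map[symmetric] sum.distinct_set_conv_list[OF dist]
    by (simp add: comp_def)
  also have "\<dots> = (\<Sum>d\<leftarrow>W. of_bool (tail_vertex G d = x) + of_bool (head_vertex G d = x))"
    using deg by (intro arg_cong[of _ _ sum_list] map_cong) auto
  also have "\<dots> = count_list (map (tail_vertex G) W) x + count_list (map (head_vertex G) W) x"
    by (simp add: sum_list_addf sum_list_of_bool)
  \<comment> \<open>Both lists become the list of visited vertices when \<open>u\<close> is put
    before the heads or after the tails.\<close>
  also have "count_list (map (head_vertex G) W) x = count_list (map (tail_vertex G) W) x"
    using arg_cong[OF walk_verts_tails[OF w], of "\<lambda>l. count_list l x"]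
    by (auto simp: walk_verts_def split: if_splits)
  also have "count_list (map (tail_vertex G) W) x = 1"
    using x tails unfolding verts_of_walk[OF w] by (simp only: distinct_count_list)
  finally show "degree G (walk_edges W) x = 2" by simp
next
  fix x y assume xy: "x \<in> verts_of G (walk_edges W)" "y \<in> verts_of G (walk_edges W)"
  obtain C D where "W = C @ D" "walk G x D u"
    using walk_split[OF w] xy(1) unfolding verts_of_walk[OF w] by metis
  moreover obtain C' D' where "W = C' @ D'" "walk G u C' y"
    using walk_split[OF w] xy(2) unfolding verts_of_walk[OF w] by metis
  moreover have "walk_edges A \<subseteq> walk_edges (A @ B)" "walk_edges B \<subseteq> walk_edges (A @ B)"
    for A B :: "('e \<times> bool) list"
    by (auto simp: walk_edges_def)
  ultimately have "(x, u) \<in> (adjacency G (walk_edges W))\<^sup>*" "(u, y) \<in> (adjacency G (walk_edges W))\<^sup>*"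
    using walk_adjacency by metis+
  then show "(x, y) \<in> (adjacency G (walk_edges W))\<^sup>*" by (rule rtrancl_trans)
qed

lemma prod_esign_walk:
  "distinct (map fst W) \<Longrightarrow> (\<Prod>e\<in>walk_edges W. esign G e) = walk_sign G W"
  unfolding walk_edges_def set_map[symmetric] walk_sign_def
  by (subst prod.distinct_set_conv_list) (auto simp: comp_def)

lemma around_walk:
  assumes "walk G u W u" "W \<noteq> []" "distinct (map (tail_vertex G) W)" "distinct (map fst W)"
  shows "around G (walk_edges W) u W"
  using circle_walk[OF assms] assms by (simp add: around_def)

end

section \<open>Hyperbalance and gain switchers\<close>

text \<open>A half edge constrains a gain switcher in the same way as a negative loop with twice its
  gain. Replacing half edges by such loops makes handcuffs of all kinds closed walks.\<close>

definition loop_graph :: "('v, 'e, 'k::field) gsgraph \<Rightarrow> 'e set \<Rightarrow> ('v, 'e, 'k) gsgraph" where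
  "loop_graph G S =
     \<lparr>verts = verts G,
      edges = {e \<in> S. ends G e \<noteq> Loose},
      ends = (\<lambda>e. case ends G e of One v \<Rightarrow> Two v v | x \<Rightarrow> x),
      esign = esign G,
      ori = (\<lambda>e. case ends G e of One v \<Rightarrow> (\<lambda>_. ori G e False) | _ \<Rightarrow> ori G e),
      gain = (\<lambda>e. case ends G e of One v \<Rightarrow> 2 * gain G e | _ \<Rightarrow> gain G e)\<rparr>"

lemma loop_graph_simps [simp]:
  "verts (loop_graph G S) = verts G"
  "esign (loop_graph G S) = esign G"
  "edges (loop_graph G S) = {e \<in> S. ends G e \<noteq> Loose}"
  by (simp_all add: loop_graph_def)

lemma walk_sign_loop_graph [simp]: "walk_sign (loop_graph G S) W = walk_sign G W"
  by (simp add: walk_sign_def)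

text \<open>Separates genuine links and loops from the loops that stand for half edges, a difference
  that \<open>loop_graph\<close> itself no longer shows.\<close>

definition link_dart :: "('v, 'e, 'k) gsgraph \<Rightarrow> 'e \<times> bool \<Rightarrow> bool" where
  "link_dart G d \<longleftrightarrow> (\<exists>v w. ends G (fst d) = Two v w)"

lemma tail_vertex_loop_graph:
  "link_dart G d \<Longrightarrow> tail_vertex (loop_graph G S) d = tail_vertex G d"
  "ends G (fst d) = One v \<Longrightarrow> tail_vertex (loop_graph G S) d = v"
  by (cases d; auto simp: tail_vertex.simps link_dart_def loop_graph_def)+

lemma link_dart_opp [simp]: "link_dart G (opp d) = link_dart G d"
  by (simp add: link_dart_def)

lemma head_vertex_loop_graph:
  "link_dart G d \<Longrightarrow> head_vertex (loop_graph G S) d = head_vertex G d"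
  "ends G (fst d) = One v \<Longrightarrow> head_vertex (loop_graph G S) d = v"
  using tail_vertex_loop_graph[of G "opp d"] by simp_all

text \<open>As a half edge has sign -1, its loop acts as a reflection, and the doubled gain puts the
  centre at the value that neutrality of the half edge forces on a gain switcher.\<close>

lemma dart_map_loop_graph:
  "link_dart G d \<Longrightarrow> dart_map (loop_graph G S) d t = dart_map G d t"
  "ends G (fst d) = One v \<Longrightarrow> dart_map (loop_graph G S) d t =
     of_int (esign G (fst d)) * t - 2 * gain G (fst d) * of_int (ori G (fst d) False)"
  by (auto simp: dart_map_def loop_graph_def link_dart_def)

lemma transport_loop_graph:
  "\<forall>d\<in>set W. link_dart G d \<Longrightarrow> transport (loop_graph G S) W t = transport G W t"
  by (induction W) (auto simp: dart_map_loop_graph)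

lemma step_loop_graph:
  "step (loop_graph G S) d \<longleftrightarrow> fst d \<in> S \<and> ends G (fst d) \<noteq> Loose"
  by (auto simp: step_def loop_graph_def split: ends.splits)

section \<open>Closed walks of the loop graph as figures of the graph\<close>

context gain_signed_graph
begin

lemma loop_graph_gain_signed_graph:
  assumes "S \<subseteq> edges G" shows "gain_signed_graph (loop_graph G S)"
proof
  let ?H = "loop_graph G S"
  show "finite (verts ?H)" using finite_verts by simp
  show "finite (edges ?H)" using assms finite_edges by (auto intro: finite_subset)
  fix e assume "e \<in> edges ?H"
  then have e: "e \<in> edges G" "ends G e \<noteq> Loose" using assms by auto
  show "set_ends (ends ?H e) \<subseteq> verts ?H"
    using ends_in_verts[OF e(1)] by (auto simp: loop_graph_def split: ends.splits)
  show "esign ?H e \<in> {1, -1}" using sign_range[OF e(1)] by simp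
  show "esign ?H e = -1" if "ends ?H e = One v" for v
    using that by (auto simp: loop_graph_def split: ends.splits)
  show "esign ?H e = 1" if "ends ?H e = Loose"
    using that e by (auto simp: loop_graph_def split: ends.splits)
  show "ori ?H e False \<in> {1, -1}" if "ends ?H e = One v" for v
    using that by (auto simp: loop_graph_def split: ends.splits)
  show "ori ?H e False \<in> {1, -1} \<and> ori ?H e True \<in> {1, -1} \<and>
      ori ?H e False * ori ?H e True = - esign ?H e" if "ends ?H e = Two v w" for v w
    using that ori_two[OF e(1)] ori_half[OF e(1)] sign_half[OF e(1)]
    by (cases "ends G e") (auto simp: loop_graph_def)
qed

lemma walk_loop_graph:
  assumes "S \<subseteq> edges G" "\<forall>d\<in>set W. link_dart G d" "walk (loop_graph G S) u W v"
  shows "walk G u W v" "walk_edges W \<subseteq> S"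
proof -
  have "walk G u W v \<and> walk_edges W \<subseteq> S"
    using assms
  proof (induction W arbitrary: u)
    case (Cons d W)
    then have "step G d" by (auto simp: step_loop_graph step_def link_dart_def)
    with Cons show ?case
      by (auto simp: tail_vertex_loop_graph head_vertex_loop_graph walk_edges_def step_loop_graph)
  qed (auto simp: walk_edges_def)
  then show "walk G u W v" "walk_edges W \<subseteq> S" by auto
qed

lemma tails_loop_graph:
  "\<forall>d\<in>set W. link_dart G d \<Longrightarrow> map (tail_vertex (loop_graph G S)) W = map (tail_vertex G) W"
  by (simp add: tail_vertex_loop_graph)

text \<open>A half edge leads back to the vertex it left, so any further step of a closed walk would
  repeat this vertex as a tail.\<close>

lemma half_dart_closed_walk:
  assumes S: "S \<subseteq> edges G" and w: "walk (loop_graph G S) u W u"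
    and tails: "distinct (map (tail_vertex (loop_graph G S)) W)"
    and d: "d \<in> set W" "\<not> link_dart G d"
  shows "W = [d]" "ends G (fst d) = One u" "half_edge G (fst d)"
proof -
  interpret H: gain_signed_graph "loop_graph G S" by (rule loop_graph_gain_signed_graph[OF S])
  have "step (loop_graph G S) d" using H.walk_steps[OF w d(1)] .
  then have S': "fst d \<in> S" "ends G (fst d) \<noteq> Loose" by (auto simp: step_loop_graph)
  then obtain v where v: "ends G (fst d) = One v"
    using d(2) by (cases "ends G (fst d)") (auto simp: link_dart_def)
  then have th: "tail_vertex (loop_graph G S) d = v" "head_vertex (loop_graph G S) d = v"
    by (auto simp: tail_vertex_loop_graph head_vertex_loop_graph)
  obtain A B where W: "W = A @ d # B" using split_list[OF d(1)] by blast
  obtain z where "walk (loop_graph G S) u A z" "walk (loop_graph G S) z (d # B) u"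
    using w unfolding W H.walk_append_iff by blast
  with th have wA: "walk (loop_graph G S) u A v" and wB: "walk (loop_graph G S) v B u" by auto
  have t': "distinct (map (tail_vertex (loop_graph G S)) A @ v # map (tail_vertex (loop_graph G S)) B)"
    using tails W th by simp
  have "B = []" using wB t' by (cases B) auto
  moreover from this have "u = v" using wB by simp
  moreover from this have "A = []" using wA t' by (cases A) auto
  ultimately show "W = [d]" "ends G (fst d) = One u" using W v by auto
  show "half_edge G (fst d)" using S S' v by (auto simp: half_edge_def)
qed

text \<open>If no half edge occurs, a repeated edge would make the walk \<open>[d, opp d]\<close>,
  which is positive; so the walk goes once around a circle.\<close>

lemma simple_negative_closed_walk:
  assumes S: "S \<subseteq> edges G" and w: "walk (loop_graph G S) u W u" and sg: "walk_sign G W = -1"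
    and tails: "distinct (map (tail_vertex (loop_graph G S)) W)"
  obtains (half) d where "W = [d]" "half_edge G (fst d)" "ends G (fst d) = One u"
      "verts_of G (walk_edges W) = set (map (tail_vertex (loop_graph G S)) W)"
  | (circle) "\<forall>d\<in>set W. link_dart G d" "negative_circle G (walk_edges W)"
      "around G (walk_edges W) u W"
      "verts_of G (walk_edges W) = set (map (tail_vertex (loop_graph G S)) W)"
proof (cases "\<forall>d\<in>set W. link_dart G d")
  case True
  have w': "walk G u W u" and S': "walk_edges W \<subseteq> S" using walk_loop_graph[OF S True w] by auto
  have t: "distinct (map (tail_vertex G) W)" using tails tails_loop_graph[OF True] by simp
  have ne: "W \<noteq> []" using sg by auto
  have dist: "distinct (map fst W)"
  proof (rule ccontr)
    assume "\<not> ?thesis"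
    then obtain d where W: "W = [d, opp d]" using closed_walk_repeated_edge[OF w' t] by metis
    then have "fst d \<in> edges G" using S S' by (auto simp: walk_edges_def)
    with esign_cases[of "fst d"] show False using sg W by auto
  qed
  have "around G (walk_edges W) u W" by (rule around_walk[OF w' ne t dist])
  moreover from this have "negative_circle G (walk_edges W)"
    using prod_esign_walk[OF dist] sg by (simp add: negative_circle_def around_def)
  ultimately show thesis
    using that(2)[OF True] verts_of_walk[OF w'] tails_loop_graph[OF True] by simp
next
  case False
  then obtain d where d: "d \<in> set W" "\<not> link_dart G d" by blast
  note * = half_dart_closed_walk[OF S w tails d]
  show thesis
    by (rule that(1)[OF *(1,3,2)])
      (use * in \<open>simp add: verts_of_def walk_edges_def tail_vertex_loop_graph\<close>)
qed

lemma hyperbalanced_gain: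
  "hyperbalanced G S \<Longrightarrow> C \<subseteq> S \<Longrightarrow> circuit_gain G C g \<Longrightarrow> g = 0"
proof -
  assume h: "hyperbalanced G S" "C \<subseteq> S" and g: "circuit_gain G C g"
  from g have "sign_circuit G C"
    unfolding sign_circuit_def by cases blast+
  with h g show "g = 0" by (auto simp: hyperbalanced_def neutral_circuit_def)
qed

text \<open>Extremal cuffs form a handcuff contained in \<open>S\<close>, and neutrality of its
  circuit walk is precisely the equality of transports that \<open>cuffs\<close> denies. The
  computation differs for circles and half edges.\<close>

lemma minimal_cuffs_frustrated:
  assumes S: "S \<subseteq> edges G" and hyp: "hyperbalanced G S"
    and N: "neutral_below (loop_graph G S) N" and c: "minimal_cuffs (loop_graph G S) N x L A y M"
  shows False
proof -
  let ?H = "loop_graph G S"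
  interpret H: gain_signed_graph ?H by (rule loop_graph_gain_signed_graph[OF S])
  \<comment> \<open>The rule \<open>half_circle\<close> lists the half edge first; hence the proviso
    on \<open>L\<close> and \<open>M\<close>, which is met at the end by swapping the cuffs.\<close>
  have main: False if c: "minimal_cuffs ?H N x L A y M"
    and half_first: "(\<exists>d\<in>set M. \<not> link_dart G d) \<Longrightarrow> (\<exists>d\<in>set L. \<not> link_dart G d)" for x L A y M
  proof -
    note cu = c[unfolded minimal_cuffs_def cuffs_def walk_sign_loop_graph]
    obtain t where t: "transport ?H L (transport ?H A t) \<noteq> transport ?H A (transport ?H M t)"
      using cu by blast
    have wL: "walk ?H x L x" and sL: "walk_sign G L = -1" and wM: "walk ?H y M y"
      and sM: "walk_sign G M = -1" and wA: "walk ?H x A y"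
      using cu by auto
    note c' = H.minimal_cuffs_swap[OF c]
    note si = H.minimal_cuffs_simple[OF N c] and si' = H.minimal_cuffs_simple[OF N c']
    have pA: "path ?H x A y" using si(2) .
    \<comment> \<open>The loop of a half edge would repeat its vertex on the path.\<close>
    have linkA: "\<forall>d\<in>set A. link_dart G d"
    proof (rule ccontr)
      assume "\<not> ?thesis"
      then obtain d where d: "d \<in> set A" "\<not> link_dart G d" by blast
      then have "ends G (fst d) \<noteq> Loose"
        using H.walk_steps[OF wA] by (simp add: step_loop_graph)
      with d obtain v where v: "ends G (fst d) = One v"
        by (cases "ends G (fst d)") (auto simp: link_dart_def)
      obtain B C where A: "A = B @ d # C" using split_list[OF d(1)] by blast
      obtain z where "walk ?H x B z" "walk ?H z (d # C) y"
        using wA unfolding A H.walk_append_iff by blast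
      with v have "walk ?H v C y" by (simp add: head_vertex_loop_graph)
      then have "v \<in> set (map (tail_vertex ?H) C @ [y])" by (cases C) auto
      then show False
        using pA A v H.walk_verts_tails[OF wA] by (auto simp: path_def tail_vertex_loop_graph)
    qed
    have A: "walk G x A y" "walk_edges A \<subseteq> S" using walk_loop_graph[OF S linkA wA] by auto
    have vA: "walk_verts G x A = walk_verts ?H x A"
      using walk_verts_tails[OF A(1)] H.walk_verts_tails[OF wA] tails_loop_graph[OF linkA] by simp
    have pathA: "path G x A y" using pA A vA by (simp add: path_def)
    have vL: "verts_of G (walk_edges L) = set (map (tail_vertex ?H) L)"
      using simple_negative_closed_walk[OF S wL sL si(1)] by metis
    have vM: "verts_of G (walk_edges M) = set (map (tail_vertex ?H) M)"
      using simple_negative_closed_walk[OF S wM sM si'(1)] by metis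
    have eS: "walk_edges W \<subseteq> S" if "walk ?H u W v" for u W v
      using H.walk_edges_subset[OF that] by auto
    have nL: "negative_figure G (walk_edges L)"
      using simple_negative_closed_walk[OF S wL sL si(1)] by (force simp: negative_figure_def walk_edges_def)
    have nM: "negative_figure G (walk_edges M)"
      using simple_negative_closed_walk[OF S wM sM si'(1)] by (force simp: negative_figure_def walk_edges_def)
    have "set (walk_verts ?H x A) = set (walk_verts ?H y (reverse_walk A))"
      using H.walk_verts_reverse[OF wA] by simp
    then have LA: "set (walk_verts G x A) \<inter> verts_of G (walk_edges L) = {x}"
      and MA: "set (walk_verts G x A) \<inter> verts_of G (walk_edges M) = {y}"
      and LM: "verts_of G (walk_edges L) \<inter> verts_of G (walk_edges M) \<subseteq> {x} \<inter> {y}"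
      using si(3,4) si'(3,4) vL vM vA by auto
    have A_Nil: "A = [] \<longleftrightarrow> x = y"
      using pathA A by (cases A) (auto simp: path_def walk_verts_tails)
    \<comment> \<open>Equal edge sets would shrink both cuffs to the same single edge at one vertex.
      They would act alike, and \<open>A\<close> would be empty.\<close>
    have ne: "walk_edges L \<noteq> walk_edges M"
    proof
      assume eq: "walk_edges L = walk_edges M"
      have "x \<in> verts_of G (walk_edges L)" using LA by auto
      with LM eq have L1: "verts_of G (walk_edges L) = {x}" and xy: "x = y" by auto
      have "set (map (tail_vertex ?H) L) = {x}" "set (map (tail_vertex ?H) M) = {x}"
        using L1 vL vM eq by simp_all
      then have "length L = 1" "length M = 1"
        using distinct_card[OF si(1)] distinct_card[OF si'(1)] by simp_all
      then obtain d d' where d: "L = [d]" "M = [d']" by (auto simp: length_Suc_conv)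
      with eq have "fst d = fst d'" by (simp add: walk_edges_def)
      then have "d' = d \<or> d' = opp d" by (cases d; cases d') (auto simp: opp_def)
      moreover have "transport ?H [opp d] s = transport ?H [d] s" for s
        using H.transport_reverse_negative[OF wL, of s] sL d by simp
      ultimately have "transport ?H M s = transport ?H L s" for s using d by auto
      then show False using t A_Nil xy by simp
    qed
    have cuff: "handcuff G (walk_edges L) (walk_edges M) x A y"
    proof (cases "A = []")
      case True
      with A_Nil LA MA LM have "verts_of G (walk_edges L) \<inter> verts_of G (walk_edges M) = {x}" by auto
      with nL nM ne True A_Nil show ?thesis by (simp add: handcuff_def)
    next
      case False
      with A_Nil LM have "verts_of G (walk_edges L) \<inter> verts_of G (walk_edges M) = {}" by auto
      with nL nM ne pathA LA MA show ?thesis by (simp add: handcuff_def)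
    qed
    have sub: "walk_edges L \<union> walk_edges M \<union> walk_edges A \<subseteq> S"
      using eS[OF wL] eS[OF wM] A(2) by simp
    have tA: "transport ?H A s = transport G A s" for s
      by (rule transport_loop_graph[OF linkA])
    from S wL sL si(1) show False
    proof (cases rule: simple_negative_closed_walk)
      case L: circle
      with half_first have linkM: "\<forall>d\<in>set M. link_dart G d" by blast
      from S wM sM si'(1) have aM: "around G (walk_edges M) y M"
      proof (cases rule: simple_negative_closed_walk)
        case (half d)
        then show ?thesis using linkM by (auto simp: link_dart_def)
      qed
      have "walk_gain G (L @ A @ M @ reverse_walk A) = 0"
        by (rule hyperbalanced_gain[OF hyp sub circuit_gain.circle_circle[OF cuff L(3) aM]])
      moreover have "walk_sign G (L @ A @ M @ reverse_walk A) = 1"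
        using sL sM walk_sign_cases[OF A(1)] by auto
      ultimately have "transport G (L @ A @ M @ reverse_walk A) s = s" for s
        by (simp add: transport_def del: walk_sign_simps)
      from this[of "transport G A (transport G M t)"]
      have "transport G L (transport G A t) = transport G A (transport G M t)"
        using transport_reverse[OF A(1)] transport_negative[OF sM] by simp
      then show False
        using t tA transport_loop_graph[OF L(1)] transport_loop_graph[OF linkM] by simp
    next
      case L: (half d)
      let ?\<tau> = "of_int (ori G (fst d) False) :: 'k" and ?\<phi> = "gain G (fst d)"
      have eL: "walk_edges L = {fst d}" using L by (simp add: walk_edges_def)
      have "esign G (fst d) = -1" using L sL by simp
      then have tL: "transport ?H L s = - s - 2 * ?\<phi> * ?\<tau>" for s
        using dart_map_loop_graph(2)[OF L(3)] L(1) by simp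
      from S wM sM si'(1) show False
      proof (cases rule: simple_negative_closed_walk)
        case M: circle
        let ?P = "A @ M @ reverse_walk A"
        \<comment> \<open>The half edge is counted at both ends. As \<open>?P\<close> is negative,
          the two contributions add up to the doubled gain of the loop instead of
          cancelling.\<close>
        have "ultrawalk_gain G (Some (fst d)) ?P (Some (fst d)) = 0"
          by (rule hyperbalanced_gain[OF hyp _ circuit_gain.half_circle[OF _ L(2) M(3)]])
            (use sub cuff eL in auto)
        moreover have sP: "walk_sign G ?P = -1"
          using sM walk_sign_cases[OF A(1)] by auto
        ultimately have "walk_gain G ?P = - 2 * ?\<phi> * ?\<tau>"
          by (simp add: ultrawalk_gain_def algebra_simps add_eq_0_iff del: walk_sign_simps)
        with sP have "transport G ?P s = - s - 2 * ?\<phi> * ?\<tau>" for s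
          by (simp add: transport_def del: walk_sign_simps)
        with tL have "transport ?H L s = transport G ?P s" for s by simp
        from this[of "transport G A t"]
        have "transport ?H L (transport G A t) = transport G A (transport G M t)"
          using transport_reverse[OF A(1)] by simp
        then show False
          using t tA transport_loop_graph[OF M(1)] by simp
      next
        case M: (half e)
        let ?\<tau>' = "of_int (ori G (fst e) False) :: 'k" and ?\<phi>' = "gain G (fst e)"
        have eM: "walk_edges M = {fst e}" using M by (simp add: walk_edges_def)
        have "esign G (fst e) = -1" using M sM by simp
        then have tM: "transport ?H M s = - s - 2 * ?\<phi>' * ?\<tau>'" for s
          using dart_map_loop_graph(2)[OF M(3)] M(1) by simp
        have "ultrawalk_gain G (Some (fst d)) A (Some (fst e)) = 0"
          by (rule hyperbalanced_gain[OF hyp _ circuit_gain.half_half[OF _ L(2) M(2)]])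
            (use sub cuff eL eM in auto)
        then have g: "walk_gain G A = ?\<phi>' * of_int (walk_sign G A) * ?\<tau>' - ?\<phi> * ?\<tau>"
          by (simp add: ultrawalk_gain_def algebra_simps add_eq_0_iff)
        have "transport ?H L (transport G A t) = transport G A (transport ?H M t)"
          unfolding tL tM transport_def[of G A] g by (simp add: algebra_simps)
        then show False using t tA by simp
      qed
    qed
  qed
  show False
  proof (cases "(\<exists>d\<in>set M. \<not> link_dart G d) \<longrightarrow> (\<exists>d\<in>set L. \<not> link_dart G d)")
    case True
    then show False using main[OF c] by blast
  next
    case False
    then show False using main[OF H.minimal_cuffs_swap[OF c]] by blast
  qed
qed


section \<open>Induction on the length of positive closed walks\<close>

lemma minimal_cuffs_exists:
  assumes "cuffs G x L A y M" "cost L A M = N"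
  obtains x L A y M where "minimal_cuffs G N x L A y M"
proof -
  define P where "P k \<longleftrightarrow> (\<exists>x L A y M. cuffs G x L A y M \<and> cost L A M = N \<and> length A = k)" for k
  have 1: "P (length A)" unfolding P_def using assms by blast
  have 2: "\<forall>k. P k \<longrightarrow> k \<le> N" by (auto simp: P_def cost_def)
  have "P (Greatest P)" using GreatestI_nat[of P, OF 1] 2 by blast
  then obtain x L A y M where *: "cuffs G x L A y M" "cost L A M = N" "length A = Greatest P"
    unfolding P_def[of "Greatest P"] by blast
  have "length A' \<le> length A" if "cuffs G x' L' A' y' M'" "cost L' A' M' = N" for x' L' A' y' M'
  proof -
    have "P (length A')" unfolding P_def using that by blast
    then show ?thesis using Greatest_le_nat[of P "length A'"] 2 *(3) by metis
  qed
  with * show ?thesis by (intro that[of x L A y M]) (simp add: minimal_cuffs_def)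
qed

text \<open>Let a walk of length \<open>N\<close> be split at a repeated vertex. If the piece
  \<open>D\<close> is positive, it and the rest are shorter and act trivially. If it is negative,
  \<open>D\<close> and \<open>E @ C\<close> are two negative closed walks at \<open>z\<close>, that
  is, candidates for cuffs of cost \<open>N\<close> with an empty connecting walk.\<close>

lemma neutral_below_Suc:
  assumes N: "neutral_below G N"
    and simple: "\<And>u W t. walk G u W u \<Longrightarrow> walk_sign G W = 1 \<Longrightarrow> distinct (map (tail_vertex G) W)
      \<Longrightarrow> transport G W t = t"
    and cuffs: "\<And>x L A y M. \<not> minimal_cuffs G N x L A y M"
  shows "neutral_below G (Suc N)"
  unfolding neutral_below_def
proof (intro allI impI)
  fix u W t
  assume w: "walk G u W u" and sg: "walk_sign G W = 1" and len: "length W < Suc N"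
  show "transport G W t = t"
  proof (cases "length W < N")
    case True
    with N w sg show ?thesis by (auto simp: neutral_below_def)
  next
    case False
    with len have len: "length W = N" by simp
    show ?thesis
    proof (cases "distinct (map (tail_vertex G) W)")
      case True
      with simple w sg show ?thesis by blast
    next
      case False
      obtain C D E z where W: "W = C @ D @ E" "D \<noteq> []" "E \<noteq> []"
        and CDE: "walk G u C z" "walk G z D z" "walk G z E u"
        using walk_split_repeated[OF w False] by metis
      have EC: "walk G z (E @ C) z" using walk_appendI[OF CDE(3,1)] .
      consider "walk_sign G D = 1" | "walk_sign G D = -1" using walk_sign_cases[OF CDE(2)] by blast
      then show ?thesis
      proof cases
        case 1
        have "length D < N" "length (C @ E) < N"
          using W len by auto
        moreover have "walk_sign G (C @ E) = 1" using 1 sg by (simp add: W(1))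
        ultimately have "transport G D s = s" "transport G (C @ E) s = s" for s
          using N[unfolded neutral_below_def, rule_format] CDE(2) walk_appendI[OF CDE(1,3)] 1 by blast+
        then show ?thesis by (simp add: W(1))
      next
        case 2
        have sgEC: "walk_sign G (E @ C) = -1"
          using sg 2 walk_sign_cases[OF CDE(1)] walk_sign_cases[OF CDE(3)] by (auto simp: W(1))
        have "length C + length D + length E = N" using len W(1) by simp
        then have cst: "cost D [] (E @ C) = N" by (simp add: cost_def)
        have "\<not> cuffs G z D [] z (E @ C)"
        proof
          assume "cuffs G z D [] z (E @ C)"
          from minimal_cuffs_exists[OF this cst] show False using cuffs by metis
        qed
        then have "transport G D s = transport G (E @ C) s" for s
          using CDE(2) EC 2 sgEC walk_ends_in_verts[OF EC] unfolding cuffs_def by auto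
        then have "transport G (E @ C) (transport G D s) = s" for s
          using transport_negative[OF 2] by metis
        \<comment> \<open>The walk at \<open>z\<close> with trivial action is the given one rotated;
          conjugation by \<open>E\<close> returns to \<open>u\<close>.\<close>
        from this[of "transport G E t"] have "transport G E (transport G W t) = transport G E t"
          by (simp add: W(1))
        then show ?thesis using transport_inject[OF CDE(3)] by simp
      qed
    qed
  qed
qed

lemma hyperbalanced_neutral_below:
  assumes S: "S \<subseteq> edges G" and hyp: "hyperbalanced G S"
  shows "neutral_below (loop_graph G S) N"
proof -
  let ?H = "loop_graph G S"
  interpret H: gain_signed_graph ?H by (rule loop_graph_gain_signed_graph[OF S])
  \<comment> \<open>Such a walk is empty, goes forth and back along one edge, or goes once around a
    positive circle; a half edge is excluded by its sign.\<close>
  have simple: "transport ?H W t = t"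
    if w: "walk ?H u W u" and sg: "walk_sign ?H W = 1" and tails: "distinct (map (tail_vertex ?H) W)"
    for u W t
  proof (cases "\<forall>d\<in>set W. link_dart G d")
    case True
    have w': "walk G u W u" and S': "walk_edges W \<subseteq> S" using walk_loop_graph[OF S True w] by auto
    have t: "distinct (map (tail_vertex G) W)" using tails tails_loop_graph[OF True] by simp
    consider "W = []" | "\<not> distinct (map fst W)" | "W \<noteq> []" "distinct (map fst W)" by blast
    then show ?thesis
    proof cases
      case 2
      then obtain d where W: "W = [d, opp d]" using closed_walk_repeated_edge[OF w' t] by metis
      then have "step ?H d" using w by simp
      with W H.dart_map_opp[of "opp d"] show ?thesis by simp
    next
      case 3
      have ar: "around G (walk_edges W) u W" by (rule around_walk[OF w' 3(1) t 3(2)])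
      then have "positive_circle G (walk_edges W)"
        using prod_esign_walk[OF 3(2)] sg by (simp add: positive_circle_def around_def)
      from hyperbalanced_gain[OF hyp S' circuit_gain.positive_circle[OF this ar]]
      show ?thesis using sg transport_loop_graph[OF True] by (simp add: transport_def)
    qed simp
  next
    case False
    then obtain d where d: "d \<in> set W" "\<not> link_dart G d" by blast
    note * = half_dart_closed_walk[OF S w tails d]
    have "esign G (fst d) = -1" using *(2,3) sign_half by (auto simp: half_edge_def)
    with *(1) sg show ?thesis by simp
  qed
  show ?thesis
  proof (induction N)
    case 0
    then show ?case by (simp add: neutral_below_def)
  next
    case (Suc N)
    show ?case
      using H.neutral_below_Suc[OF Suc] simple minimal_cuffs_frustrated[OF S hyp Suc] by blast
  qed
qed

lemma hyperbalanced_imp_switch: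
  assumes two: "(2::'k) \<noteq> 0" and S: "S \<subseteq> edges G" and hyp: "hyperbalanced G S"
  obtains \<theta> where "S \<subseteq> edges_switch G \<theta>"
proof -
  let ?H = "loop_graph G S"
  interpret H: gain_signed_graph ?H by (rule loop_graph_gain_signed_graph[OF S])
  have neutral: "transport ?H W t = t" if "walk ?H u W u" "walk_sign ?H W = 1" for u W t
    using hyperbalanced_neutral_below[OF S hyp, of "Suc (length W)"] that by (auto simp: neutral_below_def)
  have "\<exists>t\<in>UNIV. \<forall>W. walk ?H r W r \<longrightarrow> foldr (dart_map ?H) W t = t" for r
  proof (cases "\<exists>L. walk ?H r L r \<and> walk_sign ?H L = -1")
    case True
    then obtain L where L: "walk ?H r L r" "walk_sign ?H L = -1" by blast
    \<comment> \<open>The centre of the reflection given by \<open>L\<close>. For any other negative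
      \<open>W\<close>, the walk \<open>W @ L\<close> acts trivially, so \<open>W\<close> fixes
      \<open>t\<close> as well.\<close>
    define t where "t = walk_gain ?H L / 2"
    have Lt: "transport ?H L t = t"
      using L two by (simp add: transport_def t_def field_simps)
    have "transport ?H W t = t" if W: "walk ?H r W r" for W
      using H.walk_sign_cases[OF W]
    proof
      assume "walk_sign ?H W = -1"
      then have "transport ?H (W @ L) t = t"
        using neutral[OF H.walk_appendI[OF W L(1)]] L(2) by simp
      then show ?thesis using Lt by simp
    qed (use neutral W in blast)
    then show ?thesis unfolding transport_foldr by blast
  next
    case False
    \<comment> \<open>All closed walks at \<open>r\<close> are positive and act trivially, so any
      value would serve; 0 is an arbitrary choice.\<close>
    then have "transport ?H W 0 = 0" if "walk ?H r W r" for W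
      using H.walk_sign_cases[OF that] neutral[OF that] that by blast
    then show ?thesis unfolding transport_foldr by blast
  qed
  then obtain \<theta> where \<theta>: "\<And>d. step ?H d \<Longrightarrow> \<theta> (tail_vertex ?H d) = dart_map ?H d (\<theta> (head_vertex ?H d))"
    using H.global_section[where X = UNIV and f = "dart_map ?H"] H.dart_map_opp by auto
  have "switched_gain G \<theta> e = 0" if "e \<in> S" for e
  proof (cases "ends G e")
    case (Two v w)
    have eG: "e \<in> edges G" using S that by blast
    have "\<theta> v = of_int (esign G e) * \<theta> w - gain G e * of_int (ori G e False)"
      using \<theta>[of "(e, False)"] that Two dart_map_loop_graph(1)[of G "(e, False)"]
        tail_vertex_loop_graph(1)[of G "(e, False)"] head_vertex_loop_graph(1)[of G "(e, False)"]
      by (auto simp: step_loop_graph link_dart_def dart_map_def tail_vertex.simps head_vertex.simps)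
    then show ?thesis
      using ori_two[OF eG Two] sign_range[OF eG]
      by (auto simp: switched_gain_def Two)
  next
    case (One v)
    have eG: "e \<in> edges G" using S that by blast
    \<comment> \<open>The loop imposes twice the constraint of the half edge, and 2 can be
      cancelled.\<close>
    have "2 * (\<theta> v + gain G e * of_int (ori G e False)) = 0"
      using \<theta>[of "(e, False)"] that One dart_map_loop_graph(2)[of G "(e, False)"]
        tail_vertex_loop_graph(2)[of G "(e, False)"] head_vertex_loop_graph(2)[of G "(e, False)"]
        sign_half[OF eG One]
      by (simp add: step_loop_graph algebra_simps)
    then have "\<theta> v + gain G e * of_int (ori G e False) = 0"
      using two by (simp only: mult_eq_0_iff) simp
    then have "\<theta> v = - gain G e * of_int (ori G e False)"
      by (simp add: eq_neg_iff_add_eq_0)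
    then show ?thesis
      using ori_half[OF eG One] by (auto simp: switched_gain_def One)
  next
    case Loose
    then have "e \<in> loose_edges G" using S that by (auto simp: loose_edges_def)
    from hyperbalanced_gain[OF hyp _ circuit_gain.loose[OF this]] that
    show ?thesis by (simp add: switched_gain_def Loose)
  qed
  then show ?thesis using S by (intro that[of \<theta>]) (auto simp: edges_switch_def)
qed

section \<open>From gain switchers back to neutral circuits\<close>

lemma transport_switch:
  assumes "walk G u W v" "walk_edges W \<subseteq> edges_switch G \<theta>"
  shows "transport G W (\<theta> v) = \<theta> u"
  using assms
proof (induction W arbitrary: u)
  case (Cons d W)
  then have IH: "transport G W (\<theta> v) = \<theta> (head_vertex G d)" and d: "step G d"
    and sw: "switched_gain G \<theta> (fst d) = 0" and u: "u = tail_vertex G d"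
    by (auto simp: walk_edges_def edges_switch_def)
  show ?case
  proof (rule step_ends[OF d])
    fix v w assume *: "fst d \<in> edges G" "ends G (fst d) = Two v w"
      "tail_vertex G d = (if snd d then w else v)" "head_vertex G d = (if snd d then v else w)"
    have "of_int (ori G (fst d) False) * \<theta> v + gain G (fst d) + of_int (ori G (fst d) True) * \<theta> w = 0"
      using sw by (simp add: switched_gain_def *(2))
    then have g: "gain G (fst d) = - of_int (ori G (fst d) False) * \<theta> v - of_int (ori G (fst d) True) * \<theta> w"
      by (simp add: algebra_simps eq_neg_iff_add_eq_0)
    show ?thesis
      using ori_two[OF *(1,2)] sign_range[OF *(1)] *(3,4)
      by (cases "snd d") (auto simp: IH u dart_map_def g algebra_simps)
  qed
qed simp

lemma circle_edges_Two: "circle G C \<Longrightarrow> e \<in> C \<Longrightarrow> \<exists>v w. ends G e = Two v w"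
  by (simp add: circle_def)

lemma around_sign:
  "around G C u W \<Longrightarrow> walk_sign G W = (\<Prod>e\<in>C. esign G e)"
  using prod_esign_walk[of W] by (auto simp: around_def)

lemma negative_figure_around:
  assumes "negative_figure G C" "around G C u W" shows "walk_sign G W = -1"
proof -
  have "circle G C" using assms(2) by (simp add: around_def)
  then have "negative_circle G C"
    using assms(1) circle_edges_Two by (fastforce simp: negative_figure_def half_edge_def)
  then show ?thesis using around_sign[OF assms(2)] by (simp add: negative_circle_def)
qed

lemma handcuff_walk:
  assumes "handcuff G C1 C2 u P v"
  shows "walk G u P v" "u \<in> verts_of G C1" "v \<in> verts_of G C2"
proof -
  have "C1 \<subseteq> edges G"
    using assms by (auto simp: handcuff_def negative_figure_def negative_circle_def circle_def half_edge_def)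
  then have "verts_of G C1 \<subseteq> verts G"
    using ends_in_verts by (fastforce simp: verts_of_def)
  then show "walk G u P v" "u \<in> verts_of G C1" "v \<in> verts_of G C2"
    using assms by (auto simp: handcuff_def path_def)
qed

lemma switch_half_edge:
  assumes "half_edge G h" "h \<in> edges_switch G \<theta>" "u \<in> verts_of G {h}"
  shows "of_int (ori G h False) * gain G h = - \<theta> u"
proof -
  have e: "h \<in> edges G" "ends G h = One u"
    using assms by (auto simp: half_edge_def verts_of_def)
  then have "gain G h = - of_int (ori G h False) * \<theta> u"
    using assms(2) by (simp add: edges_switch_def switched_gain_def eq_neg_iff_add_eq_0 add.commute)
  then show ?thesis using ori_half[OF e] by auto
qed

text \<open>Transport along neutral edges carries \<theta> to itself, so a positive closed walk has
  gain 0. In an ultrawalk the half edges supply the values of \<theta> at its ends, and these cancel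
  the gain of the walk between them.\<close>

lemma switch_imp_hyperbalanced:
  assumes S: "S \<subseteq> edges_switch G \<theta>"
  shows "hyperbalanced G S"
  unfolding hyperbalanced_def neutral_circuit_def
proof (intro allI impI)
  fix C g assume "C \<subseteq> S" "circuit_gain G C g"
  from this(2,1) S have "circuit_gain G C g" "C \<subseteq> edges_switch G \<theta>" by auto
  then show "g = 0"
  proof induction
    case (loose e)
    then show ?case by (auto simp: edges_switch_def loose_edges_def switched_gain_def)
  next
    case (positive_circle C u W)
    then have w: "walk G u W u" "walk_edges W = C" and "walk_sign G W = 1"
      using around_sign[OF positive_circle(2)] by (auto simp: around_def positive_circle_def)
    with transport_switch[OF w(1), of \<theta>] positive_circle show ?case by (simp add: transport_def)
  next
    case (circle_circle C1 C2 u P v W1 W2)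
    note P = handcuff_walk[OF circle_circle(1)]
    have w: "walk G u (W1 @ P @ W2 @ reverse_walk P) u"
      using circle_circle(2,3) P walk_reverse[OF P(1)]
      by (intro walk_appendI) (auto simp: around_def)
    have "walk_sign G W1 = -1" "walk_sign G W2 = -1"
      using negative_figure_around circle_circle(1-3) by (auto simp: handcuff_def)
    then have sg: "walk_sign G (W1 @ P @ W2 @ reverse_walk P) = 1"
      using walk_sign_cases[OF P(1)] by auto
    have "walk_edges (W1 @ P @ W2 @ reverse_walk P) = C1 \<union> C2 \<union> walk_edges P"
      using circle_circle(2,3) reverse_walk_simps(6)[of P] by (auto simp: around_def walk_edges_def)
    with transport_switch[OF w, of \<theta>] sg circle_circle(4) show ?case
      by (simp add: transport_def del: walk_sign_simps)
  next
    case (half_circle h C2 u P v W2)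
    note P = handcuff_walk[OF half_circle(1)]
    have w: "walk G u (P @ W2 @ reverse_walk P) u"
      using half_circle(3) P walk_reverse[OF P(1)]
      by (intro walk_appendI) (auto simp: around_def)
    have "walk_sign G W2 = -1"
      using negative_figure_around half_circle(1,3) by (auto simp: handcuff_def)
    then have sg: "walk_sign G (P @ W2 @ reverse_walk P) = -1"
      using walk_sign_cases[OF P(1)] by auto
    have "walk_edges (P @ W2 @ reverse_walk P) = C2 \<union> walk_edges P"
      using half_circle(3) reverse_walk_simps(6)[of P] by (auto simp: around_def walk_edges_def)
    then have "walk_gain G (P @ W2 @ reverse_walk P) - \<theta> u = \<theta> u"
      using transport_switch[OF w, of \<theta>] sg half_circle(4)
      by (simp add: transport_def del: walk_sign_simps)
    moreover have "of_int (ori G h False) * gain G h = - \<theta> u"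
      using switch_half_edge[OF half_circle(2) _ P(2)] half_circle(4) by auto
    ultimately show ?case
      using sg by (simp add: ultrawalk_gain_def mult.commute del: walk_sign_simps)
  next
    case (half_half h1 h2 u P v)
    note P = handcuff_walk[OF half_half(1)]
    have "of_int (ori G h1 False) * gain G h1 = - \<theta> u" "of_int (ori G h2 False) * gain G h2 = - \<theta> v"
      using switch_half_edge[OF half_half(2) _ P(2)] switch_half_edge[OF half_half(3) _ P(3)]
        half_half(4) by auto
    moreover have "walk_gain G P + of_int (walk_sign G P) * \<theta> v = \<theta> u"
      using transport_switch[OF P(1), of \<theta>] half_half(4) by (simp add: transport_def)
    moreover have "gain G h2 * of_int (walk_sign G P) * of_int (ori G h2 False)
      = of_int (walk_sign G P) * (of_int (ori G h2 False) * gain G h2)"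
      by (simp add: ac_simps)
    ultimately show ?case
      by (simp add: ultrawalk_gain_def algebra_simps)
  qed
qed

lemma hyperbalanced_iff_switch:
  assumes "(2::'k) \<noteq> 0" "S \<subseteq> edges G"
  shows "hyperbalanced G S \<longleftrightarrow> (\<exists>\<theta>. S \<subseteq> edges_switch G \<theta>)"
  using hyperbalanced_imp_switch[OF assms] switch_imp_hyperbalanced by metis

end

section \<open>Counting balanced components\<close>

text \<open>The homogeneous form of neutrality, with integer values: the condition that a difference
  of two gain switchers meets on an edge neutral for both.\<close>

definition compatible :: "('v, 'e, 'k) gsgraph \<Rightarrow> ('v \<Rightarrow> int) \<Rightarrow> 'e \<Rightarrow> bool" where
  "compatible G \<eta> e = (case ends G e of
      Two v w \<Rightarrow> \<eta> v = esign G e * \<eta> w | One v \<Rightarrow> \<eta> v = 0 | Loose \<Rightarrow> True)"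

text \<open>On each balanced component a partial potential is zero or one of two opposite sign
  functions, and elsewhere it is zero; so the partial potentials determine the rank.\<close>

definition partial_potentials :: "('v, 'e, 'k) gsgraph \<Rightarrow> 'e set \<Rightarrow> ('v \<Rightarrow> int) set" where
  "partial_potentials G S = {\<eta> \<in> verts G \<rightarrow>\<^sub>E {-1, 0, 1}. \<forall>e\<in>S. compatible G \<eta> e}"

text \<open>Counts edge ends by edges and by vertices. On a circle all exponents are 2, so a
  function with values 1 and -1 has product 1.\<close>

lemma prod_ends_eq_prod_degree:
  fixes \<eta> :: "'v \<Rightarrow> int"
  assumes "finite C" "finite X" "verts_of G C \<subseteq> X"
  shows "(\<Prod>e\<in>C. case ends G e of Two v w \<Rightarrow> \<eta> v * \<eta> w | One v \<Rightarrow> \<eta> v | Loose \<Rightarrow> 1)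
    = (\<Prod>x\<in>X. \<eta> x ^ degree G C x)"
  using assms(1,3)
proof (induction C)
  case empty
  then show ?case by (simp add: degree_def)
next
  case (insert e C)
  have pow: "(\<Prod>x\<in>X. \<eta> x ^ of_bool (v = x)) = \<eta> v" if "v \<in> X" for v
  proof -
    have "(\<Prod>x\<in>X. \<eta> x ^ of_bool (v = x)) = (\<Prod>x\<in>X. if v = x then \<eta> x else 1)"
      by (intro prod.cong) auto
    then show ?thesis using that assms(2) by simp
  qed
  have sub: "set_ends (ends G e) \<subseteq> X" "verts_of G C \<subseteq> X"
    using insert.prems by (auto simp: verts_of_def)
  have "(\<Prod>x\<in>X. \<eta> x ^ degree G (insert e C) x)
    = (\<Prod>x\<in>X. \<eta> x ^ (case ends G e of Two v w \<Rightarrow> of_bool (v = x) + of_bool (w = x)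
        | One v \<Rightarrow> of_bool (v = x) | Loose \<Rightarrow> 0)) * (\<Prod>x\<in>X. \<eta> x ^ degree G C x)"
    using insert.hyps by (simp add: degree_def power_add prod.distrib)
  also have "(\<Prod>x\<in>X. \<eta> x ^ (case ends G e of Two v w \<Rightarrow> of_bool (v = x) + of_bool (w = x)
        | One v \<Rightarrow> of_bool (v = x) | Loose \<Rightarrow> 0))
    = (case ends G e of Two v w \<Rightarrow> \<eta> v * \<eta> w | One v \<Rightarrow> \<eta> v | Loose \<Rightarrow> 1)"
    using sub(1) by (cases "ends G e") (simp_all add: power_add prod.distrib pow)
  finally show ?case
    using insert.IH[OF sub(2)] insert.hyps by simp
qed

section \<open>Components and their sign functions\<close>

context gain_signed_graph
begin

lemma sym_adjacency: "sym ((adjacency G S)\<^sup>*)"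
  by (intro sym_rtrancl symI) (auto simp: adjacency_def)

lemma component_eq:
  "(x, y) \<in> (adjacency G S)\<^sup>* \<Longrightarrow> (adjacency G S)\<^sup>* `` {y} = (adjacency G S)\<^sup>* `` {x}"
  using sym_adjacency[of S] by (auto dest: symD intro: rtrancl_trans)

lemma component_subset:
  assumes "S \<subseteq> edges G" "x \<in> verts G" shows "(adjacency G S)\<^sup>* `` {x} \<subseteq> verts G"
proof
  fix y assume "y \<in> (adjacency G S)\<^sup>* `` {x}"
  then have "(x, y) \<in> (adjacency G S)\<^sup>*" by simp
  then show "y \<in> verts G"
  proof induction
    case (step y z)
    then obtain e where "e \<in> S" "ends G e = Two y z \<or> ends G e = Two z y"
      by (auto simp: adjacency_def)
    then show ?case using ends_in_verts[of e] assms(1) by auto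
  qed (use assms in simp)
qed

lemma componentsE:
  assumes "B \<in> components G S" "x \<in> B"
  shows "B = (adjacency G S)\<^sup>* `` {x}"
  using assms component_eq unfolding components_def by (auto elim!: quotientE)

lemma components_nonempty: "B \<in> components G S \<Longrightarrow> \<exists>x. x \<in> B"
  unfolding components_def by (auto elim!: quotientE)

lemma component_mem: "x \<in> verts G \<Longrightarrow> (adjacency G S)\<^sup>* `` {x} \<in> components G S"
  unfolding components_def by (rule quotientI)

lemma component_edge:
  assumes B: "B \<in> components G S" and e: "e \<in> S" "ends G e = Two v w"
  shows "v \<in> B \<longleftrightarrow> w \<in> B"
proof -
  have "(v, w) \<in> (adjacency G S)\<^sup>*" "(w, v) \<in> (adjacency G S)\<^sup>*"
    using e by (auto simp: adjacency_def)
  then show ?thesis using componentsE[OF B] by blast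
qed

lemma finite_components: "finite (components G S)"
  using finite_verts by (simp add: components_def quotient_def)

text \<open>Signs are multiplicative, so splitting at repeated vertices reduces to walks with
  distinct tails; a negative one would be a negative figure.\<close>

lemma balanced_closed_walk_sign:
  assumes S: "S \<subseteq> edges G" and bal: "sign_balanced G S" and w: "walk (loop_graph G S) u W u"
  shows "walk_sign G W = 1"
  using w
proof (induction "length W" arbitrary: u W rule: less_induct)
  case less
  let ?H = "loop_graph G S"
  interpret H: gain_signed_graph ?H by (rule loop_graph_gain_signed_graph[OF S])
  show ?case
  proof (cases "distinct (map (tail_vertex ?H) W)")
    case True
    show ?thesis
    proof (rule ccontr)
      assume "walk_sign G W \<noteq> 1"
      then have "walk_sign G W = -1" using H.walk_sign_cases[OF less.prems] by simp
      from S less.prems this True show False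
      proof (cases rule: simple_negative_closed_walk)
        case (half d)
        then have "fst d \<in> S" using H.walk_edges_subset[OF less.prems] by (auto simp: walk_edges_def)
        with half bal show ?thesis by (auto simp: sign_balanced_def)
      next
        case circle
        then show ?thesis using H.walk_edges_subset[OF less.prems] bal
          by (auto simp: sign_balanced_def)
      qed
    qed
  next
    case False
    obtain C D E z where W: "W = C @ D @ E" "D \<noteq> []" "E \<noteq> []"
      "walk ?H u C z" "walk ?H z D z" "walk ?H z E u"
      using H.walk_split_repeated[OF less.prems False] by metis
    have "walk_sign G D = 1" by (rule less.hyps[OF _ W(5)]) (use W in simp)
    moreover have "walk_sign G (C @ E) = 1"
      by (rule less.hyps[OF _ H.walk_appendI[OF W(4,6)]]) (use W in simp)
    ultimately show ?thesis by (simp add: W(1))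
  qed
qed

text \<open>All closed walks in the component are positive, so they fix the value 1, and
  \<open>global_section\<close> applies with multiplication by edge signs.\<close>

lemma balanced_component_potential:
  assumes S: "S \<subseteq> edges G" and B: "B \<in> components G S" and bal: "sign_balanced G (induced G S B)"
  obtains \<zeta> where "\<And>v. v \<in> B \<Longrightarrow> \<zeta> v \<in> {1, -1::int}"
    "\<And>e v w. e \<in> S \<Longrightarrow> ends G e = Two v w \<Longrightarrow> v \<in> B \<Longrightarrow> \<zeta> v = esign G e * \<zeta> w"
proof -
  have S': "induced G S B \<subseteq> edges G" using S by (auto simp: induced_def)
  let ?H = "loop_graph G (induced G S B)"
  interpret H: gain_signed_graph ?H by (rule loop_graph_gain_signed_graph[OF S'])
  have fold: "foldr (\<lambda>d t. esign G (fst d) * t) W t = walk_sign G W * t" for W and t :: int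
    by (induction W) (simp_all add: ac_simps)
  have sgn: "esign G (fst d) \<in> {1, -1}" if "step ?H d" for d
    using that S' sign_range[of "fst d"] by (auto simp: step_loop_graph)
  obtain \<zeta> where \<zeta>: "\<And>v. v \<in> verts ?H \<Longrightarrow> \<zeta> v \<in> {1, -1::int}"
    "\<And>d. step ?H d \<Longrightarrow> \<zeta> (tail_vertex ?H d) = esign G (fst d) * \<zeta> (head_vertex ?H d)"
  proof (rule H.global_section[where X = "{1, -1::int}" and f = "\<lambda>d t. esign G (fst d) * t"])
    show "esign G (fst (opp d)) * (esign G (fst d) * t) = t" if "step ?H d" for d t
      using sgn[OF that] by auto
    show "esign G (fst d) * t \<in> {1, -1}" if "step ?H d" "t \<in> {1, -1}" for d t
      using sgn[OF that(1)] that(2) by auto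
    show "\<exists>t\<in>{1, -1}. \<forall>W. walk ?H r W r \<longrightarrow> foldr (\<lambda>d t. esign G (fst d) * t) W t = t" for r
      using balanced_closed_walk_sign[OF S' bal] by (intro bexI[of _ 1]) (auto simp: fold)
  qed auto
  have "B \<subseteq> verts G" using component_subset[OF S] B
    unfolding components_def by (auto elim!: quotientE)
  moreover have "\<zeta> v = esign G e * \<zeta> w" if e: "e \<in> S" "ends G e = Two v w" "v \<in> B" for e v w
  proof -
    have "w \<in> B" using component_edge[OF B e(1,2)] e(3) by simp
    with e have "e \<in> induced G S B" by (auto simp: induced_def)
    then show ?thesis
      using \<zeta>(2)[of "(e, False)"] e tail_vertex_loop_graph(1)[of G "(e, False)"]
        head_vertex_loop_graph(1)[of G "(e, False)"]
      by (simp add: step_loop_graph link_dart_def tail_vertex.simps head_vertex.simps)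
  qed
  ultimately show ?thesis using \<zeta>(1) by (intro that[of \<zeta>]) (auto simp: subset_iff)
qed

lemma partial_potential_adjacent:
  assumes "\<eta> \<in> partial_potentials G S" "S \<subseteq> edges G" "e \<in> S" "ends G e = Two v w"
  shows "\<eta> v = esign G e * \<eta> w" "esign G e * \<eta> v = \<eta> w"
proof -
  show "\<eta> v = esign G e * \<eta> w"
    using assms by (fastforce simp: partial_potentials_def compatible_def)
  moreover have "esign G e = 1 \<or> esign G e = -1" using assms esign_cases by blast
  ultimately show "esign G e * \<eta> v = \<eta> w" by auto
qed

lemma partial_potential_abs:
  assumes \<eta>: "\<eta> \<in> partial_potentials G S" and S: "S \<subseteq> edges G"
    and vw: "(v, w) \<in> (adjacency G S)\<^sup>*"
  shows "\<bar>\<eta> v\<bar> = \<bar>\<eta> w\<bar>"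
  using vw
proof induction
  case (step y z)
  then obtain e where e: "e \<in> S" "ends G e = Two y z \<or> ends G e = Two z y"
    by (auto simp: adjacency_def)
  moreover have "esign G e = 1 \<or> esign G e = -1" using e S esign_cases by blast
  ultimately have "\<bar>\<eta> y\<bar> = \<bar>\<eta> z\<bar>"
    using partial_potential_adjacent(1)[OF \<eta> S e(1)] by (auto simp: abs_mult)
  with step show ?case by simp
qed simp

text \<open>A nonzero value keeps its absolute value throughout the component. This rules out half
  edges and makes every circle positive, as each vertex of a circle contributes a square.\<close>

lemma partial_potential_unbalanced:
  assumes \<eta>: "\<eta> \<in> partial_potentials G S" and S: "S \<subseteq> edges G" and B: "B \<in> components G S"
    and unbal: "\<not> sign_balanced G (induced G S B)" and v: "v \<in> B"
  shows "\<eta> v = 0"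
proof (rule ccontr)
  assume "\<eta> v \<noteq> 0"
  have BV: "B \<subseteq> verts G" using component_subset[OF S] B
    unfolding components_def by (auto elim!: quotientE)
  have \<eta>B: "\<eta> x = 1 \<or> \<eta> x = -1" if "x \<in> B" for x
  proof -
    have "(v, x) \<in> (adjacency G S)\<^sup>*" using componentsE[OF B v] that by auto
    then have "\<eta> x \<noteq> 0" using partial_potential_abs[OF \<eta> S] \<open>\<eta> v \<noteq> 0\<close> by fastforce
    moreover have "\<eta> x \<in> {-1, 0, 1}" using \<eta> that BV by (auto simp: partial_potentials_def PiE_iff)
    ultimately show ?thesis by auto
  qed
  have half: False if e: "e \<in> induced G S B" "half_edge G e" for e
  proof -
    obtain x where x: "ends G e = One x" using e(2) by (auto simp: half_edge_def)
    with e(1) have "e \<in> S" "x \<in> B" by (auto simp: induced_def)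
    then have "\<eta> x = 0" using \<eta> x by (fastforce simp: partial_potentials_def compatible_def)
    with \<eta>B \<open>x \<in> B\<close> show False by fastforce
  qed
  with unbal obtain C where C: "C \<subseteq> induced G S B" "negative_circle G C"
    by (auto simp: sign_balanced_def)
  then have circ: "circle G C" and neg: "(\<Prod>e\<in>C. esign G e) = -1" by (auto simp: negative_circle_def)
  have finC: "finite C" using circ finite_edges by (auto simp: circle_def intro: finite_subset)
  have VC: "verts_of G C \<subseteq> B" using C by (auto simp: verts_of_def induced_def)
  have finV: "finite (verts_of G C)" using VC BV finite_verts by (metis finite_subset)
  have "esign G e = (case ends G e of Two v w \<Rightarrow> \<eta> v * \<eta> w | One v \<Rightarrow> \<eta> v | Loose \<Rightarrow> 1)"
    if eC: "e \<in> C" for e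
  proof -
    obtain x y where e: "ends G e = Two x y" using circle_edges_Two[OF circ eC] by blast
    have "e \<in> S" "x \<in> B" "y \<in> B" using C e eC by (auto simp: induced_def)
    then show ?thesis
      using partial_potential_adjacent(1)[OF \<eta> S _ e] \<eta>B[of x] \<eta>B[of y] by (auto simp: e)
  qed
  then have "(\<Prod>e\<in>C. esign G e) = (\<Prod>x\<in>verts_of G C. \<eta> x ^ degree G C x)"
    using prod_ends_eq_prod_degree[OF finC finV, of G \<eta>] by (simp cong: prod.cong)
  also have "\<dots> = (\<Prod>x\<in>verts_of G C. 1)"
  proof (rule prod.cong)
    fix x assume x: "x \<in> verts_of G C"
    then have "degree G C x = 2" using circ by (simp add: circle_def)
    moreover have "\<eta> x = 1 \<or> \<eta> x = -1" using \<eta>B VC x by blast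
    ultimately show "\<eta> x ^ degree G C x = 1" by auto
  qed simp
  finally show False using neg by simp
qed

text \<open>With one sign function fixed on each balanced component, a partial potential is given by
  independent coefficients -1, 0, 1.\<close>

lemma card_partial_potentials:
  assumes S: "S \<subseteq> edges G"
  shows "card (partial_potentials G S) = 3 ^ num_balanced G S"
proof -
  define Bs where "Bs = {B \<in> components G S. sign_balanced G (induced G S B)}"
  have finBs: "finite Bs" using finite_components by (simp add: Bs_def)
  define comp where "comp x = (adjacency G S)\<^sup>* `` {x}" for x
  have comp_eq: "comp v = B" if "B \<in> Bs" "v \<in> B" for v B
    using componentsE[of B S v] that by (simp add: Bs_def comp_def)
  have mem_comp: "v \<in> comp v" for v by (simp add: comp_def)
  have BsV: "B \<subseteq> verts G" if "B \<in> Bs" for B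
    using component_subset[OF S] that unfolding Bs_def components_def by (auto elim!: quotientE)
  have "\<exists>\<zeta>. (\<forall>v\<in>B. \<zeta> v \<in> {1, -1::int}) \<and>
      (\<forall>e\<in>S. \<forall>v w. ends G e = Two v w \<longrightarrow> v \<in> B \<longrightarrow> \<zeta> v = esign G e * \<zeta> w)" if "B \<in> Bs" for B
    using balanced_component_potential[OF S, of B] that unfolding Bs_def by (smt (verit) mem_Collect_eq)
  then obtain \<zeta> where \<zeta>: "\<And>B v. B \<in> Bs \<Longrightarrow> v \<in> B \<Longrightarrow> \<zeta> B v \<in> {1, -1::int}"
    "\<And>B e v w. B \<in> Bs \<Longrightarrow> e \<in> S \<Longrightarrow> ends G e = Two v w \<Longrightarrow> v \<in> B \<Longrightarrow> \<zeta> B v = esign G e * \<zeta> B w"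
    by metis
  define \<Phi> where "\<Phi> c = (\<lambda>v\<in>verts G. if comp v \<in> Bs then c (comp v) * \<zeta> (comp v) v else 0)"
    for c :: "'v set \<Rightarrow> int"
  have const: "\<eta> v * \<zeta> B v = \<eta> w * \<zeta> B w"
    if \<eta>: "\<eta> \<in> partial_potentials G S" and B: "B \<in> Bs" "v \<in> B" and vw: "(v, w) \<in> (adjacency G S)\<^sup>*"
    for \<eta> B v w
    using vw
  proof induction
    case (step y z)
    have "z \<in> B" "y \<in> B"
      using comp_eq[OF B] step.hyps unfolding comp_def
      by (auto intro: rtrancl_into_rtrancl)
    obtain e where e: "e \<in> S" "ends G e = Two y z \<or> ends G e = Two z y"
      using step.hyps by (auto simp: adjacency_def)
    moreover have "esign G e = 1 \<or> esign G e = -1" using e S esign_cases by blast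
    ultimately have "\<eta> y * \<zeta> B y = \<eta> z * \<zeta> B z"
      using partial_potential_adjacent(1)[OF \<eta> S e(1)] \<zeta>(2)[OF B(1) e(1)] \<open>z \<in> B\<close> \<open>y \<in> B\<close>
      by fastforce
    with step.IH show ?case by simp
  qed simp
  have "bij_betw \<Phi> (Bs \<rightarrow>\<^sub>E {-1, 0, 1}) (partial_potentials G S)"
    unfolding bij_betw_def
  proof
    show "inj_on \<Phi> (Bs \<rightarrow>\<^sub>E {-1, 0, 1})"
    proof (rule inj_onI)
      fix c c' assume c: "c \<in> Bs \<rightarrow>\<^sub>E {-1, 0, 1}" "c' \<in> Bs \<rightarrow>\<^sub>E {-1, 0, 1}" and eq: "\<Phi> c = \<Phi> c'"
      show "c = c'"
      proof (rule PiE_ext[OF c])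
        fix B assume B: "B \<in> Bs"
        then obtain v where v: "v \<in> B" using components_nonempty[of B S] by (auto simp: Bs_def)
        with BsV[OF B] have "v \<in> verts G" by blast
        then have "c B * \<zeta> B v = c' B * \<zeta> B v"
          using fun_cong[OF eq, of v] B comp_eq[OF B v] by (simp add: \<Phi>_def)
        then show "c B = c' B" using \<zeta>(1)[OF B v] by auto
      qed
    qed
    show "\<Phi> ` (Bs \<rightarrow>\<^sub>E {-1, 0, 1}) = partial_potentials G S"
    proof
      show "\<Phi> ` (Bs \<rightarrow>\<^sub>E {-1, 0, 1}) \<subseteq> partial_potentials G S"
      proof
        fix \<eta> assume "\<eta> \<in> \<Phi> ` (Bs \<rightarrow>\<^sub>E {-1, 0, 1})"
        then obtain c where c: "c \<in> Bs \<rightarrow>\<^sub>E {-1, 0, 1}" and \<eta>: "\<eta> = \<Phi> c" by blast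
        have "\<eta> v \<in> {-1, 0, 1}" if "v \<in> verts G" for v
        proof (cases "comp v \<in> Bs")
          case True
          then have "c (comp v) \<in> {-1, 0, 1}" using c by (rule PiE_mem[rotated])
          then show ?thesis using \<zeta>(1)[OF True mem_comp] that True by (auto simp: \<eta> \<Phi>_def)
        qed (simp add: \<eta> \<Phi>_def that)
        then have "\<eta> \<in> verts G \<rightarrow>\<^sub>E {-1, 0, 1}" by (auto simp: PiE_iff \<eta> \<Phi>_def)
        moreover have "compatible G \<eta> e" if e: "e \<in> S" for e
        proof (cases "ends G e")
          case (Two v w)
          have "v \<in> verts G" "w \<in> verts G" using ends_in_verts[of e] S e Two by auto
          moreover have "(v, w) \<in> (adjacency G S)\<^sup>*" using e Two by (auto simp: adjacency_def)
          then have "comp w = comp v" unfolding comp_def by (rule component_eq)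
          moreover have "\<zeta> (comp v) v = esign G e * \<zeta> (comp v) w" if "comp v \<in> Bs"
            using \<zeta>(2)[OF that e Two mem_comp] .
          ultimately show ?thesis by (simp add: compatible_def Two \<eta> \<Phi>_def)
        next
          case (One v)
          have eG: "e \<in> edges G" using S e by blast
          then have "half_edge G e" "e \<in> induced G S (comp v)"
            using One e mem_comp by (auto simp: half_edge_def induced_def)
          then have "comp v \<notin> Bs" by (auto simp: Bs_def sign_balanced_def)
          moreover have "v \<in> verts G" using ends_in_verts[OF eG] One by auto
          ultimately show ?thesis by (simp add: compatible_def One \<eta> \<Phi>_def)
        qed (simp add: compatible_def)
        ultimately show "\<eta> \<in> partial_potentials G S" by (simp add: partial_potentials_def)
      qed
      show "partial_potentials G S \<subseteq> \<Phi> ` (Bs \<rightarrow>\<^sub>E {-1, 0, 1})"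
      proof
        fix \<eta> assume \<eta>: "\<eta> \<in> partial_potentials G S"
        define r where "r B = (SOME x. x \<in> B)" for B :: "'v set"
        have r: "r B \<in> B" if "B \<in> Bs" for B
          unfolding r_def using someI_ex[OF components_nonempty[of B S]] that by (simp add: Bs_def)
        \<comment> \<open>Sign functions square to 1, so multiplying by \<zeta> at any one vertex of
          the component recovers the coefficient.\<close>
        define c where "c = (\<lambda>B\<in>Bs. \<eta> (r B) * \<zeta> B (r B))"
        have \<eta>V: "\<eta> \<in> verts G \<rightarrow>\<^sub>E {-1, 0, 1}" using \<eta> by (simp add: partial_potentials_def)
        have "c \<in> Bs \<rightarrow>\<^sub>E {-1, 0, 1}"
        proof (rule PiE_I)
          fix B assume B: "B \<in> Bs"
          have "\<eta> (r B) \<in> {-1, 0, 1}" by (rule PiE_mem[OF \<eta>V]) (use r[OF B] BsV[OF B] in blast)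
          moreover have "c B = \<eta> (r B) * \<zeta> B (r B)" using B by (simp add: c_def)
          ultimately show "c B \<in> {-1, 0, 1}" using \<zeta>(1)[OF B r[OF B]] by auto
        qed (simp add: c_def)
        moreover have "\<Phi> c = \<eta>"
        proof
          fix v
          show "\<Phi> c v = \<eta> v"
          proof (cases "v \<in> verts G")
            case False
            then show ?thesis using PiE_arb[OF \<eta>V False] by (simp add: \<Phi>_def)
          next
            case V: True
            show ?thesis
            proof (cases "comp v \<in> Bs")
              case True
              have "(v, r (comp v)) \<in> (adjacency G S)\<^sup>*"
                using r[OF True] by (simp add: comp_def)
              from const[OF \<eta> True mem_comp this]
              have "\<eta> v * \<zeta> (comp v) v = \<eta> (r (comp v)) * \<zeta> (comp v) (r (comp v))" .
              then show ?thesis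
                using V True \<zeta>(1)[OF True mem_comp] by (auto simp: \<Phi>_def c_def)
            next
              case False
              have "comp v \<in> components G S" using component_mem[OF V] by (simp add: comp_def)
              with False have "\<not> sign_balanced G (induced G S (comp v))" by (simp add: Bs_def)
              from partial_potential_unbalanced[OF \<eta> S \<open>comp v \<in> components G S\<close> this mem_comp]
              show ?thesis using V False by (simp add: \<Phi>_def)
            qed
          qed
        qed
        ultimately show "\<eta> \<in> \<Phi> ` (Bs \<rightarrow>\<^sub>E {-1, 0, 1})" by blast
      qed
    qed
  qed
  then have "card (partial_potentials G S) = card (Bs \<rightarrow>\<^sub>E {-1, 0, 1::int})"
    by (rule bij_betw_same_card[symmetric])
  also have "\<dots> = 3 ^ card Bs" using finBs by (simp add: card_PiE numeral_3_eq_3)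
  finally show ?thesis by (simp add: num_balanced_def Bs_def)
qed

section \<open>Rank increments and flats\<close>

lemma finite_partial_potentials: "finite (partial_potentials G S)"
  using finite_verts finite_PiE[of "verts G" "\<lambda>_. {-1, 0, 1::int}"]
  by (auto simp: partial_potentials_def intro: finite_subset)

text \<open>Read off from the counting: 3^b functions lie among the 3^n functions on the vertices.
  It keeps the subtraction in the rank from truncating.\<close>

lemma num_balanced_le: "S \<subseteq> edges G \<Longrightarrow> num_balanced G S \<le> card (verts G)"
proof -
  assume S: "S \<subseteq> edges G"
  have "card (partial_potentials G S) \<le> card (verts G \<rightarrow>\<^sub>E {-1, 0, 1::int})"
    using finite_verts by (intro card_mono finite_PiE) (auto simp: partial_potentials_def)
  then have "(3::nat) ^ num_balanced G S \<le> 3 ^ card (verts G)"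
    using finite_verts by (simp add: card_partial_potentials[OF S] card_PiE numeral_3_eq_3)
  then show ?thesis by (subst (asm) power_increasing_iff) auto
qed

lemma hyperbalanced_mono: "hyperbalanced G S \<Longrightarrow> T \<subseteq> S \<Longrightarrow> hyperbalanced G T"
  by (auto simp: hyperbalanced_def)

text \<open>Exactly the partial potentials incompatible with \<open>e\<close> are lost, so the
  number of balanced components drops iff there is one. Hyperbalance can only be lost, so the two
  contributions never offset each other.\<close>

lemma rank_less_insert_iff:
  assumes S: "S \<subseteq> edges G" and e: "e \<in> edges G"
  shows "gsg_rank G S < gsg_rank G (insert e S) \<longleftrightarrow>
    (\<exists>\<eta>\<in>partial_potentials G S. \<not> compatible G \<eta> e) \<or>
    hyperbalanced G S \<and> hyperfrustrated G (insert e S)"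
proof -
  let ?b = "num_balanced G S" and ?b' = "num_balanced G (insert e S)"
  have S': "insert e S \<subseteq> edges G" using S e by simp
  have pots: "partial_potentials G (insert e S) = {\<eta> \<in> partial_potentials G S. compatible G \<eta> e}"
    by (auto simp: partial_potentials_def)
  have mono: "hyperbalanced G (insert e S) \<Longrightarrow> hyperbalanced G S"
    using hyperbalanced_mono by blast
  note le = num_balanced_le[OF S]
  show ?thesis
  proof (cases "\<exists>\<eta>\<in>partial_potentials G S. \<not> compatible G \<eta> e")
    case True
    then have "partial_potentials G (insert e S) \<subset> partial_potentials G S" by (auto simp: pots)
    then have "(3::nat) ^ ?b' < 3 ^ ?b"
      using psubset_card_mono[OF finite_partial_potentials]
      by (simp flip: card_partial_potentials[OF S] card_partial_potentials[OF S'])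
    then have "?b' < ?b" by (subst (asm) power_strict_increasing_iff) auto
    then show ?thesis using True mono le by (auto simp: gsg_rank_def)
  next
    case False
    then have "partial_potentials G (insert e S) = partial_potentials G S" by (auto simp: pots)
    then have "(3::nat) ^ ?b' = 3 ^ ?b"
      by (simp flip: card_partial_potentials[OF S] card_partial_potentials[OF S'])
    then have "?b' = ?b" by (subst (asm) power_inject_exp) auto
    then show ?thesis using False mono by (auto simp: gsg_rank_def)
  qed
qed

lemma flats_iff:
  "F \<in> flats (matroid_M G) \<longleftrightarrow> F \<subseteq> edges G \<and>
    (\<forall>e\<in>edges G - F. (\<exists>\<eta>\<in>partial_potentials G F. \<not> compatible G \<eta> e) \<or>
      hyperbalanced G F \<and> hyperfrustrated G (insert e F))"
  using rank_less_insert_iff[of F] by (auto simp: flats_def matroid_M_def)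

end

section \<open>The two forms of closed sets\<close>

definition compatible_edges :: "('v, 'e, 'k) gsgraph \<Rightarrow> ('v \<Rightarrow> int) set \<Rightarrow> 'e set" where
  "compatible_edges G P = {e \<in> edges G. \<forall>\<eta>\<in>P. compatible G \<eta> e}"

context gain_signed_graph
begin

text \<open>Common zeros form \<open>U\<close>. The blocks are the classes of vertices at which all
  functions of \<open>P\<close> agree up to one common sign, and \<zeta> is this sign relative to a
  representative.\<close>

lemma compatible_edges_first_form: "compatible_edges G P \<in> first_form G"
proof -
  define U where "U = {v \<in> verts G. \<forall>\<eta>\<in>P. \<eta> v = 0}"
  define R where "R = {(v, w). v \<in> verts G - U \<and> w \<in> verts G - U \<and>
    (\<exists>s\<in>{1, -1}. \<forall>\<eta>\<in>P. \<eta> w = s * \<eta> v)}"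
  have equiv: "equiv (verts G - U) R"
  proof (rule equivI)
    show "R \<subseteq> (verts G - U) \<times> (verts G - U)" by (auto simp: R_def)
    show "refl_on (verts G - U) R" by (auto simp: refl_on_def R_def intro!: bexI[of _ 1])
    show "sym R" by (rule symI) (auto simp: R_def)
    show "trans R"
    proof (rule transI)
      fix x y z assume "(x, y) \<in> R" "(y, z) \<in> R"
      then obtain s s' where s: "s \<in> {1, -1}" "s' \<in> {1, -1}" and \<eta>: "\<forall>\<eta>\<in>P. \<eta> y = s * \<eta> x" "\<forall>\<eta>\<in>P. \<eta> z = s' * \<eta> y"
        and V: "x \<in> verts G - U" "z \<in> verts G - U"
        by (auto simp only: R_def split_conv mem_Collect_eq)
      have "s' * s \<in> {1, -1}" using s by auto
      moreover have "\<forall>\<eta>\<in>P. \<eta> z = (s' * s) * \<eta> x" using \<eta> by (simp add: mult.assoc)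
      ultimately show "(x, z) \<in> R" using V unfolding R_def by blast
    qed
  qed
  define rep where "rep v = (SOME u. (v, u) \<in> R)" for v
  define \<zeta> where "\<zeta> v = (if \<forall>\<eta>\<in>P. \<eta> v = \<eta> (rep v) then 1 else -1 :: int)" for v
  have rep: "(v, rep v) \<in> R" if "v \<in> verts G - U" for v
    unfolding rep_def by (rule someI[of _ v]) (use equiv that in \<open>simp add: equiv_def refl_on_def\<close>)
  have \<zeta>: "\<eta> v = \<zeta> v * \<eta> (rep v)" if "v \<in> verts G - U" "\<eta> \<in> P" for \<eta> v
    using rep[OF that(1)] that(2) by (auto simp: R_def \<zeta>_def)
  have rep_eq: "rep v = rep w" if "(v, w) \<in> R" for v w
    using equiv_class_eq[OF equiv that] by (simp add: rep_def set_eq_iff Image_def)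
  have "compatible_edges G P = induced G (edges G) U \<union>
      induced_partition G (edges_pot G (verts G - U) \<zeta>) ((verts G - U) // R) \<union> loose_edges G"
    (is "_ = ?F")
  proof (rule set_eqI)
    fix e
    show "e \<in> compatible_edges G P \<longleftrightarrow> e \<in> ?F"
    proof (cases "e \<in> edges G")
      case False
      then show ?thesis
        by (auto simp: compatible_edges_def induced_def induced_partition_def edges_pot_def loose_edges_def)
    next
      case e: True
      show ?thesis
      proof (cases "ends G e")
        case Loose
        then show ?thesis using e by (auto simp: compatible_edges_def compatible_def loose_edges_def)
      next
        case (One v)
        then have "v \<in> verts G" using ends_in_verts[OF e] by auto
        then show ?thesis using e One
          by (auto simp: compatible_edges_def compatible_def loose_edges_def induced_def
              induced_partition_def edges_pot_def U_def)
      next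
        case (Two v w)
        have V: "v \<in> verts G" "w \<in> verts G" using ends_in_verts[OF e] Two by auto
        have sg: "esign G e = 1 \<or> esign G e = -1" using esign_cases[OF e] .
        have F: "e \<in> ?F \<longleftrightarrow> v \<in> U \<and> w \<in> U \<or> (v, w) \<in> R \<and> esign G e = \<zeta> v * \<zeta> w"
        proof -
          have "(\<exists>B\<in>(verts G - U) // R. v \<in> B \<and> w \<in> B) \<longleftrightarrow> (v, w) \<in> R"
          proof
            assume "\<exists>B\<in>(verts G - U) // R. v \<in> B \<and> w \<in> B"
            then show "(v, w) \<in> R" using quotient_eq_iff[OF equiv] by blast
          next
            assume vw: "(v, w) \<in> R"
            then have "v \<in> verts G - U" by (auto simp: R_def)
            then have "v \<in> R `` {v}" "R `` {v} \<in> (verts G - U) // R"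
              using equiv_class_self[OF equiv] by (auto intro: quotientI)
            with vw show "\<exists>B\<in>(verts G - U) // R. v \<in> B \<and> w \<in> B" by blast
          qed
          moreover have "(v, w) \<in> R \<Longrightarrow> v \<in> verts G - U \<and> w \<in> verts G - U" by (auto simp: R_def)
          ultimately show ?thesis using e
            by (auto simp: Two loose_edges_def induced_def induced_partition_def edges_pot_def)
        qed
        show ?thesis
        proof
          assume "e \<in> compatible_edges G P"
          then have c: "\<eta> v = esign G e * \<eta> w" if "\<eta> \<in> P" for \<eta>
            using that Two by (auto simp: compatible_edges_def compatible_def)
          have "\<eta> v = 0 \<longleftrightarrow> \<eta> w = 0" if "\<eta> \<in> P" for \<eta> using c[OF that] sg by auto
          then have U: "v \<in> U \<longleftrightarrow> w \<in> U" using V by (simp add: U_def)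
          show "e \<in> ?F"
          proof (cases "w \<in> U")
            case True
            then show ?thesis unfolding F using U by simp
          next
            case False
            then have vU: "v \<in> verts G - U" and wU: "w \<in> verts G - U" using U V by auto
            have "\<eta> w = esign G e * \<eta> v" if "\<eta> \<in> P" for \<eta> using c[OF that] sg by auto
            then have R: "(v, w) \<in> R" using vU wU sg unfolding R_def by blast
            \<comment> \<open>Outside \<open>U\<close> some function is nonzero, which pins down the
              sign between two vertices of a block.\<close>
            obtain \<eta> where \<eta>: "\<eta> \<in> P" "\<eta> w \<noteq> 0" using wU by (auto simp: U_def)
            have "\<zeta> v * \<eta> (rep v) = esign G e * (\<zeta> w * \<eta> (rep v))"
              using c[OF \<eta>(1)] \<zeta>[OF vU \<eta>(1)] \<zeta>[OF wU \<eta>(1)] rep_eq[OF R] by simp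
            moreover have "\<eta> (rep v) \<noteq> 0" using \<zeta>[OF wU \<eta>(1)] \<eta>(2) rep_eq[OF R] by auto
            ultimately have "esign G e = \<zeta> v * \<zeta> w" by (auto simp: \<zeta>_def split: if_splits)
            with R show ?thesis unfolding F by simp
          qed
        next
          assume "e \<in> ?F"
          then consider "v \<in> U" "w \<in> U" | "(v, w) \<in> R" "esign G e = \<zeta> v * \<zeta> w" unfolding F by blast
          then show "e \<in> compatible_edges G P"
          proof cases
            case 1
            then show ?thesis using e Two by (auto simp: compatible_edges_def compatible_def U_def)
          next
            case 2
            have "\<eta> v = esign G e * \<eta> w" if "\<eta> \<in> P" for \<eta>
            proof -
              have "v \<in> verts G - U" "w \<in> verts G - U" using 2(1) by (auto simp: R_def)
              from this[THEN \<zeta>, OF that] have "\<eta> v = \<zeta> v * \<eta> (rep v)" "\<eta> w = \<zeta> w * \<eta> (rep v)"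
                by (simp_all add: rep_eq[OF 2(1)])
              then show ?thesis unfolding 2(2) by (simp add: \<zeta>_def)
            qed
            then show ?thesis using e Two by (simp add: compatible_edges_def compatible_def)
          qed
        qed
      qed
    qed
  qed
  moreover have "partition_on (verts G - U) ((verts G - U) // R)"
    using equiv by (rule partition_on_quotient)
  moreover have "U \<subseteq> verts G" "\<zeta> \<in> verts G - U \<rightarrow> {1, -1}" by (auto simp: U_def \<zeta>_def)
  ultimately show ?thesis unfolding first_form_def by blast
qed

text \<open>The family consists of all functions that vanish on \<open>U\<close> and are a multiple
  of \<zeta> on each block; it is large enough to detect both the blocks and the signs.\<close>

lemma first_form_compatible_edges:
  assumes "X \<in> first_form G"
  obtains P where "P \<subseteq> verts G \<rightarrow>\<^sub>E {-1, 0, 1}" "X = compatible_edges G P"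
proof -
  obtain U \<pi> \<zeta> where U: "U \<subseteq> verts G" and part: "partition_on (verts G - U) \<pi>"
    and \<zeta>: "\<zeta> \<in> verts G - U \<rightarrow> {1, -1}"
    and X: "X = induced G (edges G) U \<union>
      induced_partition G (edges_pot G (verts G - U) \<zeta>) \<pi> \<union> loose_edges G"
    using assms unfolding first_form_def by blast
  have \<zeta>1: "\<zeta> v = 1 \<or> \<zeta> v = -1" if "v \<in> verts G - U" for v
    using \<zeta> that by auto
  define P where "P = {\<eta> \<in> verts G \<rightarrow>\<^sub>E {-1, 0, 1}. (\<forall>v\<in>U. \<eta> v = 0) \<and>
    (\<forall>B\<in>\<pi>. \<forall>v\<in>B. \<forall>w\<in>B. \<eta> v * \<zeta> v = \<eta> w * \<zeta> w)}"
  have P_zero: "\<eta> v = 0" if "\<eta> \<in> P" "v \<in> U" for \<eta> v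
    using that unfolding P_def by blast
  have P_const: "\<eta> v * \<zeta> v = \<eta> w * \<zeta> w" if "\<eta> \<in> P" "B \<in> \<pi>" "v \<in> B" "w \<in> B" for \<eta> B v w
    using that unfolding P_def by blast
  have cover: "\<Union>\<pi> = verts G - U" using part by (simp add: partition_on_def)
  \<comment> \<open>Test functions supported on one block. A link leaving the block, a half edge in
    it, or an edge of the wrong sign inside it is incompatible with this function.\<close>
  define \<eta>B where "\<eta>B B = (\<lambda>v\<in>verts G. if v \<in> B then \<zeta> v else 0)" for B
  have \<eta>B: "\<eta>B B \<in> P" if B: "B \<in> \<pi>" for B
  proof -
    have BV: "B \<subseteq> verts G - U" using cover B by blast
    have disj: "v \<in> B \<longleftrightarrow> w \<in> B" if "B' \<in> \<pi>" "v \<in> B'" "w \<in> B'" for B' v w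
      using part B that by (auto simp: partition_on_def disjoint_def)
    have "\<eta>B B \<in> verts G \<rightarrow>\<^sub>E {-1, 0, 1}"
    proof (rule PiE_I)
      fix v assume "v \<in> verts G"
      then show "\<eta>B B v \<in> {-1, 0, 1}" using \<zeta>1[of v] BV by (auto simp: \<eta>B_def)
    qed (simp add: \<eta>B_def)
    moreover have "\<eta>B B v = 0" if "v \<in> U" for v
      using BV that U by (auto simp: \<eta>B_def)
    moreover have "\<eta>B B v * \<zeta> v = \<eta>B B w * \<zeta> w" if "B' \<in> \<pi>" "v \<in> B'" "w \<in> B'" for B' v w
    proof -
      have "v \<in> verts G - U" "w \<in> verts G - U" using cover that by auto
      then show ?thesis using disj[OF that] \<zeta>1[of v] \<zeta>1[of w] by (auto simp: \<eta>B_def)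
    qed
    ultimately show ?thesis unfolding P_def by blast
  qed
  have "X = compatible_edges G P"
  proof (rule set_eqI)
    fix e
    show "e \<in> X \<longleftrightarrow> e \<in> compatible_edges G P"
    proof (cases "e \<in> edges G")
      case False
      then show ?thesis
        by (auto simp: X compatible_edges_def induced_def induced_partition_def edges_pot_def loose_edges_def)
    next
      case e: True
      show ?thesis
      proof (cases "ends G e")
        case Loose
        then show ?thesis using e by (auto simp: X compatible_edges_def compatible_def loose_edges_def)
      next
        case (One v)
        then have V: "v \<in> verts G" using ends_in_verts[OF e] by auto
        have "v \<in> U" if "\<forall>\<eta>\<in>P. \<eta> v = 0"
        proof (rule ccontr)
          assume "v \<notin> U"
          with V cover obtain B where "B \<in> \<pi>" "v \<in> B" by blast
          then have "\<zeta> v = 0" using that \<eta>B[of B] V by (auto simp: \<eta>B_def)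
          then show False using \<zeta>1[of v] V \<open>v \<notin> U\<close> by auto
        qed
        then have "v \<in> U \<longleftrightarrow> (\<forall>\<eta>\<in>P. \<eta> v = 0)" using P_zero by blast
        then show ?thesis using e One
          by (auto simp: X compatible_edges_def compatible_def loose_edges_def induced_def
              induced_partition_def edges_pot_def)
      next
        case (Two v w)
        have V: "v \<in> verts G" "w \<in> verts G" using ends_in_verts[OF e] Two by auto
        have sg: "esign G e = 1 \<or> esign G e = -1" using esign_cases[OF e] .
        have X': "e \<in> X \<longleftrightarrow> v \<in> U \<and> w \<in> U \<or> (\<exists>B\<in>\<pi>. v \<in> B \<and> w \<in> B \<and> esign G e = \<zeta> v * \<zeta> w)"
          using e cover
          by (auto simp: X Two loose_edges_def induced_def induced_partition_def edges_pot_def)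
        show ?thesis
        proof
          assume "e \<in> X"
          then have "\<eta> v = esign G e * \<eta> w" if "\<eta> \<in> P" for \<eta>
            unfolding X'
          proof
            assume "\<exists>B\<in>\<pi>. v \<in> B \<and> w \<in> B \<and> esign G e = \<zeta> v * \<zeta> w"
            then obtain B where B: "B \<in> \<pi>" "v \<in> B" "w \<in> B" "esign G e = \<zeta> v * \<zeta> w" by blast
            have "\<eta> v * \<zeta> v = \<eta> w * \<zeta> w" by (rule P_const[OF that B(1-3)])
            moreover have "\<zeta> v = 1 \<or> \<zeta> v = -1" "\<zeta> w = 1 \<or> \<zeta> w = -1" using B cover \<zeta>1 by blast+
            ultimately show ?thesis unfolding B(4) by auto
          qed (simp add: P_zero[OF that])
          then show "e \<in> compatible_edges G P" using e Two
            by (simp add: compatible_edges_def compatible_def)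
        next
          assume "e \<in> compatible_edges G P"
          then have c: "\<eta> v = esign G e * \<eta> w" if "\<eta> \<in> P" for \<eta>
            using that Two by (auto simp: compatible_edges_def compatible_def)
          show "e \<in> X"
          proof (cases "v \<in> U \<and> w \<in> U")
            case True
            then show ?thesis by (simp add: X')
          next
            case False
            then obtain B where B: "B \<in> \<pi>" "v \<in> B \<or> w \<in> B" using cover V by blast
            have BV: "B \<subseteq> verts G - U" using cover B(1) by blast
            have *: "\<eta>B B v = esign G e * \<eta>B B w" using c[OF \<eta>B[OF B(1)]] .
            have "v \<in> B \<and> w \<in> B"
            proof (rule ccontr)
              assume "\<not> (v \<in> B \<and> w \<in> B)"
              then have "\<zeta> v = 0 \<and> v \<in> B \<or> \<zeta> w = 0 \<and> w \<in> B"
                using * B(2) V sg by (auto simp: \<eta>B_def split: if_splits)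
              then show False using \<zeta>1 BV by fastforce
            qed
            then have vw: "v \<in> B" "w \<in> B" by auto
            with * V have "\<zeta> v = esign G e * \<zeta> w" by (simp add: \<eta>B_def)
            then have "esign G e = \<zeta> v * \<zeta> w"
              using \<zeta>1[of v] \<zeta>1[of w] vw BV by (auto simp: subset_iff)
            with vw B(1) show ?thesis unfolding X' by blast
          qed
        qed
      qed
    qed
  qed
  then show ?thesis by (intro that[of P]) (unfold P_def, blast)
qed

end

text \<open>Separates the condition on gains from that on signs: restriction to
  \<open>edges_switch G \<theta>\<close> commutes with inducing.\<close>

lemma second_form_eq:
  "second_form G = {edges_switch G \<theta> \<inter> X | \<theta> X. X \<in> first_form G}"
proof -
  define A where "A U \<pi> \<zeta> = induced G (edges G) U \<union>
      induced_partition G (edges_pot G (verts G - U) \<zeta>) \<pi> \<union> loose_edges G" for U \<pi> \<zeta>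
  have "induced G (edges_switch G \<theta>) U
        \<union> induced_partition G (edges_switch G \<theta> \<inter> edges_pot G (verts G - U) \<zeta>) \<pi>
        \<union> neutral_loose_edges G
    = edges_switch G \<theta> \<inter> A U \<pi> \<zeta>" for \<theta> U \<zeta> \<pi>
  proof -
    have "induced G (edges_switch G \<theta>) U = edges_switch G \<theta> \<inter> induced G (edges G) U"
      by (auto simp: induced_def edges_switch_def)
    moreover have "induced_partition G (edges_switch G \<theta> \<inter> A) \<pi> = edges_switch G \<theta> \<inter> induced_partition G A \<pi>"
      for A by (auto simp: induced_def induced_partition_def)
    moreover have "neutral_loose_edges G = edges_switch G \<theta> \<inter> loose_edges G"
      by (auto simp: neutral_loose_edges_def loose_edges_def edges_switch_def switched_gain_def)
    ultimately show ?thesis by (simp only: A_def Int_Un_distrib)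
  qed
  then show ?thesis
    unfolding second_form_def first_form_def A_def[symmetric] by (simp only:) blast
qed

section \<open>Flats and the two forms\<close>

context gain_signed_graph
begin

text \<open>Collapsing the values of \<open>\<theta>' - \<theta>\<close> by an odd function turns a difference of gain switchers
  into a partial potential.\<close>

lemma partial_potential_of_switches:
  assumes two: "(2::'k) \<noteq> 0"
    and F: "F \<subseteq> edges_switch G \<theta>" "F \<subseteq> edges_switch G \<theta>'"
    and e: "e \<in> edges_switch G \<theta>'" "e \<notin> edges_switch G \<theta>"
  obtains \<eta> where "\<eta> \<in> partial_potentials G F" "\<not> compatible G \<eta> e"
proof -
  define x where "x v = \<theta>' v - \<theta> v" for v
  have diff: "switched_gain G \<theta>' e - switched_gain G \<theta> e = (case ends G e of
      Two v w \<Rightarrow> of_int (ori G e False) * (x v - of_int (esign G e) * x w)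
    | One v \<Rightarrow> of_int (ori G e False) * x v | Loose \<Rightarrow> 0)" if eG: "e \<in> edges G" for e
  proof (cases "ends G e")
    case (Two v w)
    then show ?thesis using ori_two[OF eG Two] sign_range[OF eG]
      by (auto simp: switched_gain_def x_def algebra_simps)
  qed (simp_all add: switched_gain_def x_def algebra_simps)
  have F_adj: "x v = of_int (esign G f) * x w" if "f \<in> F" "ends G f = Two v w" for f v w
  proof -
    have fG: "f \<in> edges G" using F that by (auto simp: edges_switch_def)
    have "switched_gain G \<theta>' f = 0" "switched_gain G \<theta> f = 0" using F that by (auto simp: edges_switch_def)
    then have "of_int (ori G f False) * (x v - of_int (esign G f) * x w) = 0"
      using diff[OF fG] that(2) by simp
    then show ?thesis using ori_two[OF fG that(2)] by auto
  qed
  have F_half: "x v = 0" if "f \<in> F" "ends G f = One v" for f v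
  proof -
    have fG: "f \<in> edges G" using F that by (auto simp: edges_switch_def)
    have "switched_gain G \<theta>' f = 0" "switched_gain G \<theta> f = 0" using F that by (auto simp: edges_switch_def)
    then have "of_int (ori G f False) * x v = 0"
      using diff[OF fG] that(2) by simp
    then show ?thesis using ori_half[OF fG that(2)] by auto
  qed
  \<comment> \<open>Oddness of \<open>f a\<close> needs \<open>a\<close> to differ from
    \<open>- a\<close>; this is where characteristic 2 is excluded.\<close>
  define f where "f a k = (if k = a then 1 else if k = - a then -1 else 0 :: int)" for a k :: 'k
  have odd: "f a (of_int s * k) = s * f a k" if "a \<noteq> 0" "s = 1 \<or> s = -1" for a k s
  proof -
    have "a + a \<noteq> 0" using that(1) two by (simp flip: mult_2)
    then have "a \<noteq> - a" by (metis add.right_inverse)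
    then show ?thesis using that by (auto simp: f_def minus_equation_iff)
  qed
  define \<eta> where "\<eta> a = (\<lambda>v\<in>verts G. f a (x v))" for a
  have pot: "\<eta> a \<in> partial_potentials G F" if a: "a \<noteq> 0" for a
    unfolding partial_potentials_def
  proof (intro CollectI conjI ballI)
    show "\<eta> a \<in> verts G \<rightarrow>\<^sub>E {-1, 0, 1}" by (auto simp: \<eta>_def f_def)
    fix e' assume e': "e' \<in> F"
    have eG: "e' \<in> edges G" using F e' by (auto simp: edges_switch_def)
    show "compatible G (\<eta> a) e'"
    proof (cases "ends G e'")
      case (Two v w)
      have "v \<in> verts G" "w \<in> verts G" using ends_in_verts[OF eG] Two by auto
      then show ?thesis
        using F_adj[OF e' Two] odd[OF a esign_cases[OF eG]] by (simp add: compatible_def Two \<eta>_def)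
    next
      case (One v)
      have "v \<in> verts G" using ends_in_verts[OF eG] One by auto
      then show ?thesis
        using F_half[OF e' One] a by (simp add: compatible_def One \<eta>_def f_def)
    qed (simp add: compatible_def)
  qed
  have eG: "e \<in> edges G" using e(1) by (simp add: edges_switch_def)
  have ne: "switched_gain G \<theta>' e - switched_gain G \<theta> e \<noteq> 0"
    using e by (auto simp: edges_switch_def)
  show ?thesis
  proof (cases "ends G e")
    case (Two v w)
    have V: "v \<in> verts G" "w \<in> verts G" using ends_in_verts[OF eG] Two by auto
    have neq: "x v \<noteq> of_int (esign G e) * x w" using ne diff[OF eG] Two by auto
    \<comment> \<open>The parameter of \<open>f\<close> is a nonzero value of \<open>x\<close> at an
      end of \<open>e\<close>, so that this end gets the value 1 and the other end cannot match it
      through the edge sign.\<close>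
    show ?thesis
    proof (cases "x v = 0")
      case True
      with neq have w0: "x w \<noteq> 0" by auto
      show ?thesis
      proof (rule that[OF pot[OF w0]])
        show "\<not> compatible G (\<eta> (x w)) e"
          using V True w0 esign_cases[OF eG] by (auto simp: compatible_def Two \<eta>_def f_def)
      qed
    next
      case False
      show ?thesis
      proof (rule that[OF pot[OF False]])
        have "f (x v) (x v) \<noteq> f (x v) (of_int (esign G e) * x w)" using neq by (simp add: f_def)
        then show "\<not> compatible G (\<eta> (x v)) e"
          using V odd[OF False esign_cases[OF eG]] by (simp add: compatible_def Two \<eta>_def)
      qed
    qed
  next
    case (One v)
    have V: "v \<in> verts G" using ends_in_verts[OF eG] One by auto
    have v0: "x v \<noteq> 0" using ne diff[OF eG] One by auto
    show ?thesis
      by (rule that[OF pot[OF v0]]) (use V in \<open>simp add: compatible_def One \<eta>_def f_def\<close>)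
  next
    case Loose
    then show ?thesis using ne diff[OF eG] by simp
  qed
qed

lemma subset_partial_potentials:
  "P \<subseteq> verts G \<rightarrow>\<^sub>E {-1, 0, 1} \<Longrightarrow> F \<subseteq> compatible_edges G P \<Longrightarrow> P \<subseteq> partial_potentials G F"
  by (auto simp: partial_potentials_def compatible_edges_def)

text \<open>Every function of the defining family is a partial potential of \<open>X\<close>, so an
  edge outside \<open>X\<close> always meets an incompatible one.\<close>

lemma first_form_flat: "X \<in> first_form G \<Longrightarrow> X \<in> flats (matroid_M G)"
proof (rule first_form_compatible_edges)
  fix P assume P: "P \<subseteq> verts G \<rightarrow>\<^sub>E {-1, 0, 1}" and X: "X = compatible_edges G P"
  show "X \<in> flats (matroid_M G)"
    using subset_partial_potentials[OF P, of X] X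
    unfolding flats_iff by (auto simp: compatible_edges_def)
qed

lemma second_form_hyperbalanced: "X \<in> second_form G \<Longrightarrow> hyperbalanced G X"
  unfolding second_form_eq using switch_imp_hyperbalanced by blast

text \<open>An outside edge that violates the sign condition is detected by the family
  \<open>P\<close>. Otherwise it is not neutral under \<theta>: either hyperbalance is lost, or some
  \<theta>' serves the enlarged set, and the difference of \<theta>' and \<theta> yields an
  incompatible potential.\<close>

lemma second_form_flat:
  assumes two: "(2::'k) \<noteq> 0" and "X \<in> second_form G"
  shows "X \<in> flats (matroid_M G)"
proof -
  obtain \<theta> Y where X: "X = edges_switch G \<theta> \<inter> Y" and "Y \<in> first_form G"
    using assms(2) unfolding second_form_eq by blast
  then obtain P where P: "P \<subseteq> verts G \<rightarrow>\<^sub>E {-1, 0, 1}" and Y: "Y = compatible_edges G P"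
    using first_form_compatible_edges by metis
  have XG: "X \<subseteq> edges G" by (auto simp: X edges_switch_def)
  show ?thesis
    unfolding flats_iff
  proof (intro conjI ballI XG)
    fix e assume e: "e \<in> edges G - X"
    show "(\<exists>\<eta>\<in>partial_potentials G X. \<not> compatible G \<eta> e) \<or>
      hyperbalanced G X \<and> hyperfrustrated G (insert e X)"
    proof (cases "e \<in> Y")
      case False
      then obtain \<eta> where "\<eta> \<in> P" "\<not> compatible G \<eta> e" using e by (auto simp: Y compatible_edges_def)
      moreover have "P \<subseteq> partial_potentials G X"
        by (rule subset_partial_potentials[OF P]) (simp add: X Y)
      ultimately show ?thesis by blast
    next
      case True
      then have e\<theta>: "e \<notin> edges_switch G \<theta>" using e X by blast
      show ?thesis
      proof (cases "hyperbalanced G (insert e X)")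
        case True
        then obtain \<theta>' where "insert e X \<subseteq> edges_switch G \<theta>'"
          using hyperbalanced_iff_switch[OF two, of "insert e X"] e XG by auto
        then have "X \<subseteq> edges_switch G \<theta>'" "e \<in> edges_switch G \<theta>'" by auto
        from partial_potential_of_switches[OF two _ this e\<theta>] X show ?thesis by blast
      next
        case False
        with second_form_hyperbalanced[OF assms(2)] show ?thesis by blast
      qed
    qed
  qed
qed

lemma flat_subset: "F \<in> flats (matroid_M G) \<Longrightarrow> F \<subseteq> edges G"
  by (simp add: flats_def matroid_M_def)

text \<open>Hyperbalance cannot be lost any more, so only partial potentials keep edges out of
  \<open>F\<close>.\<close>

lemma hyperfrustrated_flat_first_form:
  assumes "F \<in> flats (matroid_M G)" "hyperfrustrated G F"
  shows "F \<in> first_form G"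
proof -
  have "F = compatible_edges G (partial_potentials G F)"
  proof
    show "F \<subseteq> compatible_edges G (partial_potentials G F)"
      using flat_subset[OF assms(1)] by (auto simp: compatible_edges_def partial_potentials_def)
    show "compatible_edges G (partial_potentials G F) \<subseteq> F"
      using assms unfolding flats_iff compatible_edges_def by blast
  qed
  then show ?thesis using compatible_edges_first_form by metis
qed

text \<open>Adding an edge that is neutral under a switcher for \<open>F\<close> preserves
  hyperbalance, so among these edges again only partial potentials decide.\<close>

lemma hyperbalanced_flat_second_form:
  assumes two: "(2::'k) \<noteq> 0" and F: "F \<in> flats (matroid_M G)" and hyp: "hyperbalanced G F"
  shows "F \<in> second_form G"
proof -
  obtain \<theta> where \<theta>: "F \<subseteq> edges_switch G \<theta>"
    using hyperbalanced_imp_switch[OF two flat_subset[OF F] hyp] .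
  let ?P = "partial_potentials G F"
  have "edges_switch G \<theta> \<inter> compatible_edges G ?P \<subseteq> F"
  proof
    fix e assume e: "e \<in> edges_switch G \<theta> \<inter> compatible_edges G ?P"
    then have "hyperbalanced G (insert e F)" using \<theta> by (intro switch_imp_hyperbalanced) auto
    then show "e \<in> F" using F e unfolding flats_iff by (auto simp: compatible_edges_def)
  qed
  moreover have "F \<subseteq> compatible_edges G ?P"
    using flat_subset[OF F] by (auto simp: compatible_edges_def partial_potentials_def)
  ultimately have "F = edges_switch G \<theta> \<inter> compatible_edges G ?P" using \<theta> by blast
  then show ?thesis unfolding second_form_eq using compatible_edges_first_form by blast
qed

lemma flats_matroid_M:
  assumes "(2::'k) \<noteq> 0"
  shows "flats (matroid_M G) = first_form G \<union> second_form G"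
    and "{F \<in> flats (matroid_M G). hyperbalanced G F} = second_form G"
  using first_form_flat second_form_flat[OF assms] hyperfrustrated_flat_first_form
    hyperbalanced_flat_second_form[OF assms] second_form_hyperbalanced by blast+

section \<open>Adjoining the edge at infinity\<close>

lemma add_infinity_gain_signed_graph: "gain_signed_graph (add_infinity G)"
proof
  let ?H = "add_infinity G"
  show "finite (verts ?H)" "finite (edges ?H)"
    using finite_verts finite_edges by (simp_all add: add_infinity_def)
  fix e assume e: "e \<in> edges ?H"
  show "set_ends (ends ?H e) \<subseteq> verts ?H" "esign ?H e \<in> {1, -1}"
    using e ends_in_verts sign_range by (auto simp: add_infinity_def split: option.splits)
  show "esign ?H e = -1" if "ends ?H e = One v" for v
    using that e sign_half by (auto simp: add_infinity_def split: option.splits)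
  show "esign ?H e = 1" if "ends ?H e = Loose"
    using that e sign_loose by (auto simp: add_infinity_def split: option.splits)
  show "ori ?H e False \<in> {1, -1} \<and> ori ?H e True \<in> {1, -1} \<and>
      ori ?H e False * ori ?H e True = - esign ?H e" if "ends ?H e = Two v w" for v w
    using that e ori_two by (cases e) (auto simp: add_infinity_def)
  show "ori ?H e False \<in> {1, -1}" if "ends ?H e = One v" for v
    using that e ori_half by (cases e) (auto simp: add_infinity_def)
qed

lemma edges_add_infinity: "edges (add_infinity G) = insert None (Some ` edges G)"
  by (simp add: add_infinity_def)

lemma compatible_edges_add_infinity:
  "compatible_edges (add_infinity G) P = insert None (Some ` compatible_edges G P)"
proof -
  have "compatible (add_infinity G) \<eta> (Some e) = compatible G \<eta> e"
    "compatible (add_infinity G) \<eta> None" for \<eta> e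
    by (simp_all add: compatible_def add_infinity_def split: ends.splits)
  then show ?thesis by (auto simp: compatible_edges_def edges_add_infinity)
qed

lemma edges_switch_add_infinity: "edges_switch (add_infinity G) \<theta> = Some ` edges_switch G \<theta>"
proof -
  have "switched_gain (add_infinity G) \<theta> (Some e) = switched_gain G \<theta> e"
    "switched_gain (add_infinity G) \<theta> None = 1" for e
    by (simp_all add: switched_gain_def add_infinity_def split: ends.splits)
  then show ?thesis by (auto simp: edges_switch_def edges_add_infinity)
qed

text \<open>Being loose, \<open>None\<close> is compatible with every function. Passing through
  \<open>compatible_edges\<close> avoids carrying \<open>U\<close>, \<pi> and \<zeta> from one graph
  to the other.\<close>

lemma first_form_add_infinity:
  "first_form (add_infinity G) = (\<lambda>S. insert None (Some ` S)) ` first_form G"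
proof -
  interpret H: gain_signed_graph "add_infinity G" by (rule add_infinity_gain_signed_graph)
  show ?thesis
  proof
    show "first_form (add_infinity G) \<subseteq> (\<lambda>S. insert None (Some ` S)) ` first_form G"
    proof
      fix X assume "X \<in> first_form (add_infinity G)"
      then obtain P where "X = compatible_edges (add_infinity G) P"
        using H.first_form_compatible_edges by metis
      then show "X \<in> (\<lambda>S. insert None (Some ` S)) ` first_form G"
        using compatible_edges_first_form by (simp add: compatible_edges_add_infinity)
    qed
    show "(\<lambda>S. insert None (Some ` S)) ` first_form G \<subseteq> first_form (add_infinity G)"
    proof
      fix X assume "X \<in> (\<lambda>S. insert None (Some ` S)) ` first_form G"
      then obtain Y where "Y \<in> first_form G" and X: "X = insert None (Some ` Y)" by blast
      then obtain P where "Y = compatible_edges G P"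
        using first_form_compatible_edges by metis
      with X show "X \<in> first_form (add_infinity G)"
        using H.compatible_edges_first_form[of P] by (simp add: compatible_edges_add_infinity)
    qed
  qed
qed

lemma second_form_add_infinity:
  "second_form (add_infinity G) = (\<lambda>S. Some ` S) ` second_form G"
proof -
  have Int: "Some ` A \<inter> insert None (Some ` B) = Some ` (A \<inter> B)" for A B :: "'e set" by auto
  have "second_form (add_infinity G)
    = {Some ` edges_switch G \<theta> \<inter> insert None (Some ` X) | \<theta> X. X \<in> first_form G}"
    unfolding second_form_eq first_form_add_infinity edges_switch_add_infinity by blast
  also have "\<dots> = (\<lambda>S. Some ` S) ` second_form G"
    unfolding second_form_eq Int by blast
  finally show ?thesis .
qed

end

theorem theorem5p3:
  fixes \<Upsilon> :: "('v, 'e, 'k::field) gsgraph"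
  assumes "gain_signed_graph \<Upsilon>"
    and "CHAR('k) \<noteq> 2"
  shows "flats (matroid_M \<Upsilon>) = first_form \<Upsilon> \<union> second_form \<Upsilon> \<and>
    (\<forall>S\<in>second_form \<Upsilon>. hyperbalanced \<Upsilon> S) \<and>
    (\<forall>S\<in>flats (matroid_M \<Upsilon>). hyperbalanced \<Upsilon> S \<longrightarrow> S \<in> second_form \<Upsilon>) \<and>
    {F \<in> flats (matroid_M_inf \<Upsilon>). hyperbalanced (add_infinity \<Upsilon>) F}
      = (\<lambda>S. Some ` S) ` {S \<in> flats (matroid_M \<Upsilon>). hyperbalanced \<Upsilon> S} \<and>
    {F \<in> flats (matroid_M_inf \<Upsilon>). hyperfrustrated (add_infinity \<Upsilon>) F}
      = (\<lambda>S. insert None (Some ` S)) ` first_form \<Upsilon> \<and>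
    (\<forall>S\<subseteq>edges \<Upsilon>. hyperfrustrated \<Upsilon> S \<longrightarrow>
      (insert None (Some ` S) \<in> flats (matroid_M_inf \<Upsilon>) \<longleftrightarrow> S \<in> flats (matroid_M \<Upsilon>)))"
proof -
  interpret gain_signed_graph \<Upsilon> by fact
  interpret inf: gain_signed_graph "add_infinity \<Upsilon>" by (rule add_infinity_gain_signed_graph)
  have two: "(2::'k) \<noteq> 0"
  proof
    assume "(2::'k) = 0"
    then have "of_nat 2 = (0::'k)" by simp
    then have "CHAR('k) dvd 2" by (simp only: of_nat_eq_0_iff_char_dvd)
    then have "CHAR('k) \<le> 2" by (rule dvd_imp_le) simp
    moreover have "CHAR('k) \<noteq> 0"
      using \<open>CHAR('k) dvd 2\<close> by (metis dvd_0_left zero_neq_numeral)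
    ultimately show False
      using assms(2) CHAR_not_1[where 'a = 'k] by linarith
  qed
  note M = flats_matroid_M[OF two] and M_inf = inf.flats_matroid_M[OF two, folded matroid_M_inf_def]
  have frustrated: "hyperfrustrated (add_infinity \<Upsilon>) F" if "None \<in> F" for F
  proof -
    have "circuit_gain (add_infinity \<Upsilon>) {None} 1"
      using circuit_gain.loose[of None "add_infinity \<Upsilon>"] by (simp add: loose_edges_def add_infinity_def)
    then show ?thesis using inf.hyperbalanced_gain[of F "{None}" 1] that by auto
  qed
  have hyper_inf: "{F \<in> flats (matroid_M_inf \<Upsilon>). hyperbalanced (add_infinity \<Upsilon>) F}
      = (\<lambda>S. Some ` S) ` {S \<in> flats (matroid_M \<Upsilon>). hyperbalanced \<Upsilon> S}"
    unfolding M(2) M_inf(2) by (rule second_form_add_infinity)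
  \<comment> \<open>All of the first form occurs here: a set of the first form that happens to be
    hyperbalanced becomes hyperfrustrated by adding \<open>None\<close>, and gives one flat with and
    one without it.\<close>
  have frus_inf: "{F \<in> flats (matroid_M_inf \<Upsilon>). hyperfrustrated (add_infinity \<Upsilon>) F}
      = (\<lambda>S. insert None (Some ` S)) ` first_form \<Upsilon>"
  proof -
    have "hyperfrustrated (add_infinity \<Upsilon>) F" if "F \<in> first_form (add_infinity \<Upsilon>)" for F
      using that frustrated unfolding first_form_add_infinity by auto
    then have "{F \<in> first_form (add_infinity \<Upsilon>) \<union> second_form (add_infinity \<Upsilon>).
        hyperfrustrated (add_infinity \<Upsilon>) F} = first_form (add_infinity \<Upsilon>)"
      using inf.second_form_hyperbalanced by auto
    then show ?thesis unfolding M_inf(1) by (simp only: first_form_add_infinity)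
  qed
  have "insert None (Some ` S) \<in> flats (matroid_M_inf \<Upsilon>) \<longleftrightarrow> S \<in> flats (matroid_M \<Upsilon>)"
    if S: "hyperfrustrated \<Upsilon> S" for S
  proof -
    have inj: "inj (\<lambda>S. insert None (Some ` S))"
      by (rule injI) (auto simp: set_eq_iff image_iff)
    have "insert None (Some ` S) \<in> flats (matroid_M_inf \<Upsilon>) \<longleftrightarrow>
        insert None (Some ` S) \<in> (\<lambda>S. insert None (Some ` S)) ` first_form \<Upsilon>"
      unfolding frus_inf[symmetric] using frustrated by simp
    also have "\<dots> \<longleftrightarrow> S \<in> first_form \<Upsilon>" using inj by (rule inj_image_mem_iff)
    also have "\<dots> \<longleftrightarrow> S \<in> flats (matroid_M \<Upsilon>)"
      using M(1) S second_form_hyperbalanced by blast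
    finally show ?thesis .
  qed
  then show ?thesis
    using M hyper_inf frus_inf second_form_hyperbalanced by blast
qed

end
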